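(* Let $N\ge 3$, $q>1$, $\theta\in\mathbb R$ and $\lambda>\lambda_H=(N-2)^2/4$. Then the function $$U_0(x)=\ell^{1/(q-1)}|x|^{-\Theta},\qquad x\in\mathbb R^N\setminus\{0\},$$ is the unique solution of $$-\Delta u-\frac{\lambda}{|x|^2}u+|x|^{\theta}u^q=0\quad\text{in }\mathbb R^N\setminus\{0\},\qquad u>0\quad\text{in }\mathbb R^N\setminus\{0\}.$$
   Context: Notation: $\Theta:=\frac{\theta+2}{q-1}$ and $\ell:=\Theta^2-(N-2)\Theta+\lambda$ (one has $\ell>0$ when $\lambda>\lambda_H$). A solution of the equation in $\mathbb R^N\setminus\{0\}$ is a positive function $u\in C^1(\mathbb R^N\setminus\{0\})$ such that for every $\varphi\in C^1_c(\mathbb R^N\setminus\{0\})$ ($C^1$ functions with compact support in $\mathbb R^N\setminus\{0\}$), $$\int_{\mathbb R^N}\nabla u\cdot\nabla\varphi\,dx-\int_{\mathbb R^N}\frac{\lambda}{|x|^2}u\,\varphi\,dx+\int_{\mathbb R^N}|x|^\theta u^q\varphi\,dx=0.$$ *)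

theory Defs
  imports "HOL-Analysis.Analysis"
begin

definition grad :: "('a::real_inner \<Rightarrow> real) \<Rightarrow> 'a \<Rightarrow> 'a" where
  "grad f x = (THE D. GDERIV f x :> D)"

lemma grad_eqI:
  assumes "GDERIV f x :> D"
  shows "grad f x = D"
  unfolding grad_def
proof (rule the_equality[where P = "\<lambda>D. GDERIV f x :> D", OF assms])
  fix E assume "GDERIV f x :> E"
  then have "(\<lambda>h. h \<bullet> E) = (\<lambda>h. h \<bullet> D)"
    using assms has_derivative_unique unfolding gderiv_def by blast
  then have "h \<bullet> E = h \<bullet> D" for h
    by meson
  then show "E = D"
    by (metis inner_commute vector_eq_rdot)
qed

text \<open>Intended for open sets \<open>S\<close>.\<close>

definition C1_on :: "'a::euclidean_space set \<Rightarrow> ('a \<Rightarrow> real) \<Rightarrow> bool" where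
  "C1_on S f \<longleftrightarrow> (\<forall>x\<in>S. f differentiable (at x)) \<and> continuous_on S (grad f)"

text \<open>Functions on \<open>S\<close> are represented by total functions, and a function with compact
  support in \<open>S\<close> by its extension by zero.\<close>

definition C1c_on :: "'a::euclidean_space set \<Rightarrow> ('a \<Rightarrow> real) \<Rightarrow> bool" where
  "C1c_on S \<phi> \<longleftrightarrow> C1_on S \<phi> \<and> compact (closure {x. \<phi> x \<noteq> 0}) \<and> closure {x. \<phi> x \<noteq> 0} \<subseteq> S"

text \<open>
  Weak solutions of \<open>- \<Delta> u - lam / |x|^2 u + |x|^\<theta> u^q = 0\<close>, \<open>u > 0\<close>, in the space without
  the origin. The value of \<open>u\<close> at \<open>0\<close> is irrelevant: every test function vanishes in a
  neighbourhood of \<open>0\<close>, so each integrand does too. For the same reason each integrand is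
  continuous with compact support, hence integrable.
\<close>

definition is_solution :: "real \<Rightarrow> real \<Rightarrow> real \<Rightarrow> (real ^ 'n::finite \<Rightarrow> real) \<Rightarrow> bool" where
  "is_solution q \<theta> lam u \<longleftrightarrow>
     C1_on (- {0}) u \<and> (\<forall>x\<in>- {0}. u x > 0) \<and>
     (\<forall>\<phi>. C1c_on (- {0}) \<phi> \<longrightarrow>
        (LINT x|lborel. grad u x \<bullet> grad \<phi> x)
        - (LINT x|lborel. lam / (norm x)\<^sup>2 * u x * \<phi> x)
        + (LINT x|lborel. norm x powr \<theta> * u x powr q * \<phi> x) = 0)"

definition lambda_H :: "nat \<Rightarrow> real" where
  "lambda_H N = (real N - 2)\<^sup>2 / 4"

definition Theta :: "real \<Rightarrow> real \<Rightarrow> real" where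
  "Theta q \<theta> = (\<theta> + 2) / (q - 1)"

definition ell :: "nat \<Rightarrow> real \<Rightarrow> real \<Rightarrow> real \<Rightarrow> real" where
  "ell N q \<theta> lam = (Theta q \<theta>)\<^sup>2 - (real N - 2) * Theta q \<theta> + lam"

lemma ell_pos:
  assumes "lam > lambda_H N"
  shows "ell N q \<theta> lam > 0"
proof -
  have "ell N q \<theta> lam = (Theta q \<theta> - (real N - 2) / 2)\<^sup>2 + (lam - lambda_H N)"
    by (simp add: ell_def lambda_H_def power2_eq_square field_simps)
  then show ?thesis
    using assms by (simp add: add_nonneg_pos)
qed

definition U0 :: "real \<Rightarrow> real \<Rightarrow> real \<Rightarrow> real ^ 'n::finite \<Rightarrow> real" where
  "U0 q \<theta> lam x = ell CARD('n) q \<theta> lam powr (1 / (q - 1)) * norm x powr (- Theta q \<theta>)"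

end

theory Submission
  imports Defs
begin

text \<open>In the variable \<open>t = ln |x|\<close> the equation for \<open>w = u / U\<^sub>0\<close> is autonomous, with
  \<open>w = 1\<close> as a constant solution, so radial barriers can be centred at any point. Two solutions are
  compared through their quotient (Brezis-Oswald), where the singular potential cancels. A barrier
  that blows up at the ends of an interval gives \<open>w \<le> M\<close>. Since \<open>lam > lambda_H\<close>, the
  linearisation at \<open>0\<close> oscillates, which yields a compactly supported subsolution and
  \<open>w \<ge> \<epsilon> > 0\<close>. Given these two bounds, the barriers
  \<open>1 \<plusminus> \<delta> \<plusminus> \<delta> (1 + g\<^sup>2 (t - t\<^sub>0)\<^sup>2)\<close> with small \<open>g\<close> squeeze \<open>w(t\<^sub>0)\<close> between
  \<open>1 - 2 \<delta>\<close> and \<open>1 + 2 \<delta>\<close>.\<close>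

subsection \<open>Functions of class C1\<close>

text \<open>Neither symmetry of \<open>u\<close> nor its behaviour at \<open>0\<close> or at
  infinity is prescribed, so no comparison on the whole domain has boundary data. Every estimate is
  therefore made on a bounded interval of \<open>t\<close>, with constants that do not depend on its
  centre. Comparing by differences fails there: above the Hardy constant the quadratic form of
  \<open>- \<Delta> - lam / |x|^2\<close> is negative for some test functions on long annuli, and
  the last step needs long ones. The quotient uses nothing about the linear part, only that
  \<open>s powr (q - 1)\<close> increases. In the last step the shift by \<open>\<delta>\<close>
  away from the constant solution \<open>1\<close> creates a strict reserve in the zero-order term;
  it pays for the derivatives of the parabola once \<open>g\<close> is small. The interval then has
  length of order \<open>1 / g\<close>, and the two uniform bounds are what places the barrier
  beyond \<open>u\<close> at its ends, however far away these are.\<close>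

lemma differentiable_imp_GDERIV:
  fixes f :: "'a::euclidean_space \<Rightarrow> real"
  assumes "f differentiable (at x)"
  shows "GDERIV f x :> grad f x"
proof -
  obtain D where D: "(f has_derivative D) (at x)"
    using assms by (auto simp: differentiable_def)
  then interpret bounded_linear D by (rule has_derivative_bounded_linear)
  \<comment> \<open>Riesz representation in coordinates: the gradient is read off from the values of
    the derivative on the basis.\<close>
  define d where "d = (\<Sum>b\<in>Basis. D b *\<^sub>R b)"
  have "D h = h \<bullet> d" for h
  proof -
    have "D h = D (\<Sum>b\<in>Basis. (h \<bullet> b) *\<^sub>R b)" by (simp add: euclidean_representation)
    also have "\<dots> = h \<bullet> d" by (simp add: sum scale d_def inner_sum_right mult.commute)
    finally show ?thesis .
  qed
  then have "D = (\<lambda>h. h \<bullet> d)" by blast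
  then have "GDERIV f x :> d" using D by (simp add: gderiv_def)
  then show ?thesis using grad_eqI by metis
qed

lemma C1_onI:
  assumes "\<And>x. x \<in> S \<Longrightarrow> GDERIV f x :> f' x" "continuous_on S f'"
  shows "C1_on S f"
proof -
  have "continuous_on S (grad f) \<longleftrightarrow> continuous_on S f'"
    by (rule continuous_on_cong) (auto intro: grad_eqI assms)
  then show ?thesis using assms
    by (auto simp: C1_on_def gderiv_def differentiable_def)
qed

lemma C1_on_GDERIV: "C1_on S f \<Longrightarrow> x \<in> S \<Longrightarrow> GDERIV f x :> grad f x"
  by (simp add: C1_on_def differentiable_imp_GDERIV)

lemma C1_on_grad_continuous: "C1_on S f \<Longrightarrow> continuous_on S (grad f)"
  by (simp add: C1_on_def)

lemma C1_on_continuous: "C1_on S f \<Longrightarrow> continuous_on S f"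
  by (meson C1_on_def continuous_at_imp_continuous_on differentiable_imp_continuous_within)

lemma C1_on_subset: "C1_on S f \<Longrightarrow> T \<subseteq> S \<Longrightarrow> C1_on T f"
  by (auto simp: C1_on_def intro: continuous_on_subset)

lemma C1_on_mult:
  assumes "C1_on S f" "C1_on S g"
  shows "C1_on S (\<lambda>x. f x * g x)"
proof (rule C1_onI)
  show "GDERIV (\<lambda>x. f x * g x) x :> f x *\<^sub>R grad g x + g x *\<^sub>R grad f x" if "x \<in> S" for x
    using that assms by (intro GDERIV_mult C1_on_GDERIV)
  show "continuous_on S (\<lambda>x. f x *\<^sub>R grad g x + g x *\<^sub>R grad f x)"
    using assms by (intro continuous_intros C1_on_grad_continuous C1_on_continuous)
qed

lemma grad_mult:
  assumes "C1_on S f" "C1_on S g" "x \<in> S"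
  shows "grad (\<lambda>x. f x * g x) x = f x *\<^sub>R grad g x + g x *\<^sub>R grad f x"
  using assms by (intro grad_eqI GDERIV_mult C1_on_GDERIV)

section \<open>Radial functions and annuli in the variable \<open>t = ln |x|\<close>\<close>

lemma GDERIV_ln_norm:
  assumes "x \<noteq> 0"
  shows "GDERIV (\<lambda>x. ln (norm x)) x :> x /\<^sub>R (norm x)\<^sup>2"
proof -
  have "GDERIV (\<lambda>x. ln (norm x)) x :> (1 / norm x) *\<^sub>R sgn x"
    using assms by (intro GDERIV_DERIV_compose GDERIV_norm DERIV_ln_divide) auto
  then show ?thesis by (simp add: sgn_div_norm power2_eq_square divide_inverse)
qed

lemma GDERIV_radial:
  assumes "x \<noteq> 0" "DERIV H (ln (norm x)) :> d"
  shows "GDERIV (\<lambda>x. H (ln (norm x))) x :> (d / (norm x)\<^sup>2) *\<^sub>R x"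
  using GDERIV_DERIV_compose[OF GDERIV_ln_norm[OF assms(1)] assms(2)]
  by (simp add: divide_inverse)

text \<open>Indexed by logarithmic radii, since a barrier centred at \<open>t0\<close> lives on an
  interval of \<open>t\<close>. The origin is excluded explicitly because \<open>ln\<close> is total
  and \<open>ln (norm 0)\<close> could lie in \<open>T\<close>.\<close>

definition annulus :: "real set \<Rightarrow> 'a::euclidean_space set" where
  "annulus T = {x. x \<noteq> 0 \<and> ln (norm x) \<in> T}"

lemma continuous_on_ln_norm: "S \<subseteq> - {0} \<Longrightarrow> continuous_on S (\<lambda>x::'a::euclidean_space. ln (norm x))"
  by (intro continuous_intros) auto

lemma annulus_subset: "annulus T \<subseteq> - {0}"
  by (auto simp: annulus_def)

lemma annulus_UNIV: "annulus UNIV = - {0}"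
  by (auto simp: annulus_def)

lemma open_annulus:
  assumes "open T" shows "open (annulus T :: 'a::euclidean_space set)"
proof -
  have "open ((\<lambda>x::'a. ln (norm x)) -` T \<inter> - {0})"
    using continuous_on_open_vimage[of "- {0::'a}" "\<lambda>x. ln (norm x)"] continuous_on_ln_norm assms
    by blast
  then show ?thesis by (simp add: annulus_def vimage_def Int_def conj_commute)
qed

lemma compact_annulus:
  "compact (annulus {a..b} :: 'a::euclidean_space set)"
proof -
  have "annulus {a..b} = cball (0::'a) (exp b) - ball 0 (exp a)"
    by (auto simp: annulus_def not_less ln_ge_iff)
      (metis exp_le_cancel_iff exp_ln zero_less_norm_iff norm_zero exp_gt_zero not_le)+
  then show ?thesis by (simp add: compact_diff)
qed

lemma C1_on_radial:
  assumes "\<And>t. t \<in> T \<Longrightarrow> DERIV H t :> H' t" "continuous_on T H'"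
  shows "C1_on (annulus T) (\<lambda>x. H (ln (norm x)))"
proof (rule C1_onI)
  show "GDERIV (\<lambda>x. H (ln (norm x))) x :> (H' (ln (norm x)) / (norm x)\<^sup>2) *\<^sub>R x"
    if "x \<in> annulus T" for x
    using that assms by (intro GDERIV_radial) (auto simp: annulus_def)
  show "continuous_on (annulus T) (\<lambda>x. (H' (ln (norm x)) / (norm x)\<^sup>2) *\<^sub>R x)"
    by (intro continuous_intros continuous_on_compose2[OF assms(2)] continuous_on_ln_norm)
      (auto simp: annulus_def)
qed

lemma grad_radial:
  assumes "\<And>t. t \<in> T \<Longrightarrow> DERIV H t :> H' t" "x \<in> annulus T"
  shows "grad (\<lambda>x. H (ln (norm x))) x = (H' (ln (norm x)) / (norm x)\<^sup>2) *\<^sub>R x"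
  using assms by (intro grad_eqI GDERIV_radial) (auto simp: annulus_def)

section \<open>Test functions\<close>

lemma C1c_on_eq_0:
  assumes "x \<notin> closure {x. \<phi> x \<noteq> 0}"
  shows "\<phi> x = 0" "GDERIV \<phi> x :> 0" "grad \<phi> x = 0"
proof -
  have 0: "\<phi> y = 0" if "y \<in> - closure {x. \<phi> x \<noteq> 0}" for y
    using that subsetD[OF closure_subset, of y "{x. \<phi> x \<noteq> 0}"] by blast
  then show "\<phi> x = 0" using assms by blast
  have "(\<phi> has_derivative (\<lambda>_. 0)) (at x)"
  proof (rule has_derivative_transform_within_open[OF has_derivative_const])
    show "x \<in> - closure {x. \<phi> x \<noteq> 0}" "open (- closure {x. \<phi> x \<noteq> 0})"
      using assms by (simp_all add: open_Compl)
  qed (rule 0[symmetric])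
  then show "GDERIV \<phi> x :> 0" by (simp add: gderiv_def)
  then show "grad \<phi> x = 0" by (rule grad_eqI)
qed

text \<open>Being total and zero off its support, \<open>\<phi>\<close> is its own extension.
  Continuity of the gradient is glued from two open sets that cover the space: \<open>S\<close>, and
  the complement of the closed support, where the gradient is zero.\<close>

lemma C1c_on_extend:
  assumes "C1c_on S \<phi>" "open S" "S \<subseteq> T"
  shows "C1c_on T \<phi>"
proof -
  let ?K = "closure {x. \<phi> x \<noteq> 0}"
  have \<phi>: "C1_on S \<phi>" "compact ?K" "?K \<subseteq> S" using assms by (auto simp only: C1c_on_def)
  have 0: "continuous_on (- ?K) (grad \<phi>)"
  proof (rule continuous_on_eq[OF continuous_on_const])
    show "0 = grad \<phi> x" if "x \<in> - ?K" for x
      by (rule C1c_on_eq_0(3)[symmetric]) (use that in blast)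
  qed
  have "continuous_on (S \<union> - ?K) (grad \<phi>)"
    using C1_on_grad_continuous[OF \<phi>(1)] 0 assms(2)
    by (intro continuous_on_open_Un) (simp_all add: open_Compl)
  moreover have "S \<union> - ?K = UNIV" using \<phi>(3) by blast
  ultimately have "continuous_on T (grad \<phi>)"
    by (metis continuous_on_subset subset_UNIV)
  moreover have "\<phi> differentiable at x" for x
  proof (cases "x \<in> ?K")
    case True then show ?thesis using \<phi> unfolding C1_on_def by blast
  next
    case False
    from C1c_on_eq_0(2)[OF False] show ?thesis
      unfolding gderiv_def differentiable_def by blast
  qed
  ultimately show ?thesis using \<phi> assms(3) by (simp only: C1c_on_def C1_on_def) blast
qed

lemma C1c_on_mult:
  assumes "C1c_on S \<phi>" "C1_on S g"
  shows "C1c_on S (\<lambda>x. g x * \<phi> x)"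
proof -
  have "closure {x. g x * \<phi> x \<noteq> 0} \<subseteq> closure {x. \<phi> x \<noteq> 0}"
    by (rule closure_mono) auto
  moreover from this have "compact (closure {x. g x * \<phi> x \<noteq> 0})"
    using assms compact_Int_closed[of "closure {x. \<phi> x \<noteq> 0}" "closure {x. g x * \<phi> x \<noteq> 0}"]
    by (simp add: C1c_on_def Int_absorb1)
  ultimately show ?thesis
    using assms C1_on_mult unfolding C1c_on_def by blast
qed

text \<open>Nothing is known about \<open>h1\<close> and \<open>h0\<close> outside \<open>S\<close>,
  but the integrand equals its product with the indicator of the compact support, on which it is
  continuous. The shape with two coefficients covers every term of the weak equation.\<close>

lemma C1c_on_integrable:
  assumes "C1c_on S \<phi>" "continuous_on S h1" "continuous_on S h0"
  shows "integrable lborel (\<lambda>x. h1 x \<bullet> grad \<phi> x + h0 x * \<phi> x)"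
proof -
  let ?K = "closure {x. \<phi> x \<noteq> 0}"
  let ?f = "\<lambda>x. h1 x \<bullet> grad \<phi> x + h0 x * \<phi> x"
  have "continuous_on S \<phi>" "continuous_on S (grad \<phi>)"
    using assms by (auto simp: C1c_on_def C1_on_continuous C1_on_grad_continuous)
  then have "continuous_on S ?f" using assms by (intro continuous_intros)
  then have "continuous_on ?K ?f"
    using assms by (auto simp: C1c_on_def intro: continuous_on_subset)
  then have "integrable lborel (\<lambda>x. indicator ?K x *\<^sub>R ?f x)"
    using assms by (intro borel_integrable_compact) (auto simp: C1c_on_def)
  moreover have "(\<lambda>x. indicator ?K x *\<^sub>R ?f x) = ?f"
  proof
    show "indicator ?K x *\<^sub>R ?f x = ?f x" for x
      using C1c_on_eq_0(1,3)[of x \<phi>] by (cases "x \<in> ?K") simp_all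
  qed
  ultimately show ?thesis by (rule subst[rotated])
qed

subsection \<open>Integration by parts for radial functions\<close>

lemma lborel_integral_scaleR:
  fixes f :: "'a::euclidean_space \<Rightarrow> real"
  assumes "f \<in> borel_measurable borel" "c > 0"
  shows "(LINT x|lborel. f (c *\<^sub>R x)) = (LINT x|lborel. f x) / c ^ DIM('a)"
proof -
  have "(LINT x|lborel. f x) = (LINT x|density (distr lborel borel (\<lambda>x::'a. 0 + c *\<^sub>R x)) (\<lambda>_. \<bar>c\<bar> ^ DIM('a)). f x)"
    using lborel_affine[of c "0::'a"] assms by simp
  also have "\<dots> = c ^ DIM('a) * (LINT x|lborel. f (c *\<^sub>R x))"
    using assms by (subst integral_density) (simp_all add: integral_distr)
  finally show ?thesis using assms by (simp add: field_simps)
qed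

lemma tendsto_difference_quotient_at_0:
  fixes f :: "real \<Rightarrow> real"
  assumes "DERIV f 0 :> d"
  shows "(\<lambda>n. (f (inverse (real (Suc n))) - f 0) / inverse (real (Suc n))) \<longlonglongrightarrow> d"
proof -
  have "filterlim (\<lambda>n. inverse (real (Suc n))) (at 0) sequentially"
    using LIMSEQ_inverse_real_of_nat by (intro filterlim_atI) auto
  moreover have "((\<lambda>h. (f h - f 0) / h) \<longlongrightarrow> d) (at 0)"
    using assms by (simp add: DERIV_def)
  ultimately show ?thesis by (rule filterlim_compose[rotated])
qed

text \<open>The identity is the derivative at \<open>c = 1\<close> of the scaling law for the integral of
  \<open>x \<mapsto> F (c x)\<close>; it replaces the divergence theorem.\<close>

lemma C1c_on_Euler_integral:
  fixes F :: "'a::euclidean_space \<Rightarrow> real"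
  assumes F: "C1c_on UNIV F"
  shows "(LINT x|lborel. x \<bullet> grad F x) = - real DIM('a) * (LINT x|lborel. F x)"
proof -
  let ?K = "closure {x. F x \<noteq> 0}"
  define h where "h n = inverse (real (Suc n))" for n
  define s where "s n x = (F ((1 + h n) *\<^sub>R x) - F x) / h n" for n x
  have hpos: "h n > 0" for n by (simp add: h_def)
  have C1: "C1_on UNIV F" and K: "compact ?K" using F by (auto simp: C1c_on_def)
  have contF: "continuous_on UNIV F" by (rule C1_on_continuous[OF C1])
  have gd: "GDERIV F x :> grad F x" for x using C1_on_GDERIV[OF C1] by simp
  have contG: "continuous_on UNIV (grad F)" by (rule C1_on_grad_continuous[OF C1])
  have intF: "integrable lborel F"
    using C1c_on_integrable[OF F, of "\<lambda>_. 0" "\<lambda>_. 1"] by simp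
  have measF: "F \<in> borel_measurable borel" by (rule borel_measurable_continuous_onI[OF contF])
  obtain B where B: "\<And>x. x \<in> ?K \<Longrightarrow> norm x \<le> B" "B > 0"
    using compact_imp_bounded[OF K] by (auto simp: bounded_pos)
  obtain L where L: "\<And>x. x \<in> ?K \<Longrightarrow> norm (grad F x) \<le> L" "L > 0"
  proof -
    have "compact (grad F ` ?K)"
      by (intro compact_continuous_image K continuous_on_subset[OF contG]) simp
    then show ?thesis using that compact_imp_bounded[of "grad F ` ?K"] by (auto simp: bounded_pos)
  qed
  have grad_le: "norm (grad F x) \<le> L" for x
    using L C1c_on_eq_0(3)[of x F] by (cases "x \<in> ?K") simp_all
  have lip: "\<bar>F y - F x\<bar> \<le> L * norm (y - x)" for x y
  proof -
    have "norm (F y - F x) \<le> L * norm (y - x)"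
    proof (rule differentiable_bound[where S = UNIV])
      show "(F has_derivative (\<lambda>h. h \<bullet> grad F z)) (at z within UNIV)" for z
        using gd[of z] by (simp add: gderiv_def)
      show "onorm (\<lambda>h. h \<bullet> grad F z) \<le> L" for z
      proof (rule onorm_le)
        show "norm (h \<bullet> grad F z) \<le> L * norm h" for h
          using Cauchy_Schwarz_ineq2[of h "grad F z"] mult_left_mono[OF grad_le, of "norm h" z]
          by (simp add: mult.commute)
      qed
    qed auto
    then show ?thesis by simp
  qed
  have lim_s: "(\<lambda>n. s n x) \<longlonglongrightarrow> x \<bullet> grad F x" for x
  proof -
    have "((\<lambda>t. F ((1 + t) *\<^sub>R x)) has_derivative (\<lambda>t. (t *\<^sub>R x) \<bullet> grad F x)) (at 0)"
    proof (rule has_derivative_compose[where f = "\<lambda>t. (1 + t) *\<^sub>R x"])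
      show "((\<lambda>t. (1 + t) *\<^sub>R x) has_derivative (\<lambda>t. t *\<^sub>R x)) (at 0)"
        by (auto intro!: derivative_eq_intros)
      show "(F has_derivative (\<lambda>h. h \<bullet> grad F x)) (at ((1 + 0) *\<^sub>R x))"
        using gd[of x] by (simp add: gderiv_def)
    qed
    then have "DERIV (\<lambda>t. F ((1 + t) *\<^sub>R x)) 0 :> x \<bullet> grad F x"
      by (simp add: has_field_derivative_def mult_commute_abs)
    from tendsto_difference_quotient_at_0[OF this] show ?thesis
      by (simp add: s_def h_def)
  qed
  \<comment> \<open>Only factors \<open>1 + h n > 1\<close> are used, so the dilation moves points
    outward: beyond radius \<open>B\<close> both values of \<open>F\<close> vanish, and a single
    ball carries all quotients. With the global Lipschitz bound this yields the dominating
    function.\<close>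
  have far: "F x = 0" "F ((1 + h n) *\<^sub>R x) = 0" if "\<not> norm x \<le> B" for n x
  proof -
    have "norm x \<le> norm ((1 + h n) *\<^sub>R x)"
      using hpos[of n] mult_right_mono[of 1 "1 + h n" "norm x"] by simp
    then have "x \<notin> ?K" "(1 + h n) *\<^sub>R x \<notin> ?K" using that B(1) by fastforce+
    then show "F x = 0" "F ((1 + h n) *\<^sub>R x) = 0" by (blast intro: C1c_on_eq_0(1))+
  qed
  have bound_s: "norm (s n x) \<le> indicator (cball 0 B) x * (L * B)" for n x
  proof (cases "norm x \<le> B")
    case True
    have "\<bar>F ((1 + h n) *\<^sub>R x) - F x\<bar> \<le> L * norm (h n *\<^sub>R x)"
      using lip[of "(1 + h n) *\<^sub>R x" x] by (simp add: algebra_simps)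
    also have "\<dots> \<le> L * (h n * B)" using True hpos[of n] L by simp
    finally show ?thesis using True hpos[of n] by (simp add: s_def field_simps indicator_def)
  next
    case False
    then show ?thesis using far(1)[of x] far(2)[of x n] L(2) B(2) by (simp add: s_def)
  qed
  have "(\<lambda>n. LINT x|lborel. s n x) \<longlonglongrightarrow> (LINT x|lborel. x \<bullet> grad F x)"
  proof (rule integral_dominated_convergence)
    show "(\<lambda>x. x \<bullet> grad F x) \<in> borel_measurable lborel"
      using contG by (auto intro!: borel_measurable_continuous_onI continuous_intros)
    show "s n \<in> borel_measurable lborel" for n
      unfolding s_def using contF hpos[of n]
      by (auto intro!: borel_measurable_continuous_onI continuous_intros continuous_on_compose2[OF contF])
    show "integrable lborel (\<lambda>x. indicator (cball (0::'a) B) x * (L * B))"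
      using borel_integrable_compact[of "cball (0::'a) B" "\<lambda>_. L * B"] by simp
  qed (use lim_s bound_s in auto)
  \<comment> \<open>By the scaling law the integrated quotient is a difference quotient of
    \<open>inverse ((1 + t) ^ N)\<close> at \<open>t = 0\<close>, \<open>N\<close> being the
    dimension; the derivative there is \<open>- N\<close>.\<close>
  moreover have "(LINT x|lborel. s n x)
      = (inverse ((1 + h n) ^ DIM('a)) - inverse ((1 + 0) ^ DIM('a))) / h n * (LINT x|lborel. F x)" for n
  proof -
    have "integrable lborel (\<lambda>x. F ((1 + h n) *\<^sub>R x))"
    proof -
      have "continuous_on (cball 0 B) (\<lambda>x. F ((1 + h n) *\<^sub>R x))"
        by (intro continuous_on_compose2[OF contF] continuous_intros) auto
      then have "integrable lborel (\<lambda>x. indicator (cball 0 B) x *\<^sub>R F ((1 + h n) *\<^sub>R x))"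
        by (intro borel_integrable_compact) auto
      moreover have "(\<lambda>x. indicator (cball 0 B) x *\<^sub>R F ((1 + h n) *\<^sub>R x)) = (\<lambda>x. F ((1 + h n) *\<^sub>R x))"
      proof
        show "indicator (cball 0 B) x *\<^sub>R F ((1 + h n) *\<^sub>R x) = F ((1 + h n) *\<^sub>R x)" for x
          using far(2)[of x n] by (cases "norm x \<le> B") simp_all
      qed
      ultimately show ?thesis by (simp only:)
    qed
    then show ?thesis
      using intF lborel_integral_scaleR[OF measF, of "1 + h n"] hpos[of n]
      by (simp add: s_def diff_divide_distrib divide_inverse algebra_simps)
  qed
  moreover have "(\<lambda>n. (inverse ((1 + h n) ^ DIM('a)) - inverse ((1 + 0) ^ DIM('a))) / h n * (LINT x|lborel. F x))
      \<longlonglongrightarrow> - real DIM('a) * (LINT x|lborel. F x)"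
    unfolding h_def
    by (intro tendsto_mult tendsto_const
        tendsto_difference_quotient_at_0[where f = "\<lambda>t. inverse ((1 + t) ^ DIM('a))"])
      (auto intro!: derivative_eq_intros)
  ultimately show ?thesis by (simp add: LIMSEQ_unique)
qed

text \<open>The field \<open>\<phi>\<close> times the gradient of \<open>H (ln |x|)\<close> is
  \<open>F x *\<^sub>R x\<close> with \<open>F = g \<phi>\<close> and
  \<open>g = exp (- 2 t) H'(t)\<close>, so the Euler identity for \<open>F\<close> is the divergence
  theorem for this field. The coefficient of \<open>\<phi>\<close> on the right is the Laplacian of
  \<open>H (ln |x|)\<close> written in \<open>t\<close>.\<close>

lemma radial_integral_by_parts:
  fixes \<phi> :: "'a::euclidean_space \<Rightarrow> real"
  assumes T: "open T"
    and H: "\<And>t. t \<in> T \<Longrightarrow> DERIV H t :> H' t" "\<And>t. t \<in> T \<Longrightarrow> DERIV H' t :> H'' t"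
    and cont: "continuous_on T H''"
    and \<phi>: "C1c_on (annulus T) \<phi>"
  shows "(LINT x|lborel. grad (\<lambda>x. H (ln (norm x))) x \<bullet> grad \<phi> x)
    = - (LINT x|lborel. (H'' (ln (norm x)) + (real DIM('a) - 2) * H' (ln (norm x))) / (norm x)\<^sup>2 * \<phi> x)"
proof -
  let ?S = "annulus T :: 'a set" and ?N = "real DIM('a)"
  define V where "V x = H (ln (norm x))" for x :: 'a
  define G where "G t = exp (- 2 * t) * H' t" for t
  define G' where "G' t = exp (- 2 * t) * (H'' t - 2 * H' t)" for t
  define g where "g x = G (ln (norm x))" for x :: 'a
  define F where "F x = g x * \<phi> x" for x
  have S: "open ?S" "?S \<subseteq> - {0}" using T annulus_subset by (auto intro: open_annulus)
  have cont': "continuous_on T H'"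
    using H(2) by (meson DERIV_isCont continuous_at_imp_continuous_on)
  have exp2: "exp (- 2 * ln (norm x)) = 1 / (norm x)\<^sup>2" if "x \<in> ?S" for x
    using that by (simp add: annulus_def exp_minus exp_double inverse_eq_divide)
  have G: "DERIV G t :> G' t" if "t \<in> T" for t
    unfolding G_def G'_def using that
    by (auto intro!: derivative_eq_intros H simp: algebra_simps)
  have "continuous_on T G'"
    unfolding G'_def by (intro continuous_intros cont cont')
  then have C1g: "C1_on ?S g" unfolding g_def by (intro C1_on_radial[OF G])
  have C1V: "C1_on ?S V" unfolding V_def by (intro C1_on_radial[OF H(1)] cont')
  have \<phi>': "C1_on ?S \<phi>" "closure {x. \<phi> x \<noteq> 0} \<subseteq> ?S" using \<phi> by (simp_all add: C1c_on_def)
  have FS: "C1c_on ?S F" unfolding F_def by (rule C1c_on_mult[OF \<phi> C1g])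
  then have F: "C1c_on UNIV F" using C1c_on_extend S(1) by blast
  let ?h = "\<lambda>x. (H'' (ln (norm x)) + (?N - 2) * H' (ln (norm x))) / (norm x)\<^sup>2"
  have pointwise: "x \<bullet> grad F x + ?N * F x = grad V x \<bullet> grad \<phi> x + ?h x * \<phi> x" for x
  proof (cases "x \<in> ?S")
    case True
    then have x: "x \<noteq> 0" "ln (norm x) \<in> T" by (simp_all add: annulus_def)
    have 1: "grad F x = g x *\<^sub>R grad \<phi> x + \<phi> x *\<^sub>R grad g x"
      unfolding F_def by (rule grad_mult[OF C1g \<phi>'(1) True])
    have 2: "x \<bullet> grad g x = (H'' (ln (norm x)) - 2 * H' (ln (norm x))) / (norm x)\<^sup>2"
    proof -
      have "grad g x = (G' (ln (norm x)) / (norm x)\<^sup>2) *\<^sub>R x"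
        unfolding g_def by (rule grad_radial[OF G True])
      then show ?thesis
        using x by (simp add: G'_def exp2[OF True, simplified] power2_norm_eq_inner field_simps)
    qed
    have 3: "g x = H' (ln (norm x)) / (norm x)\<^sup>2"
      by (simp add: g_def G_def exp2[OF True, simplified])
    have 4: "grad V x = (H' (ln (norm x)) / (norm x)\<^sup>2) *\<^sub>R x"
      unfolding V_def by (rule grad_radial[OF H(1) True])
    have "x \<bullet> grad F x = g x * (x \<bullet> grad \<phi> x) + \<phi> x * (x \<bullet> grad g x)"
      unfolding 1 by (simp add: inner_add_right)
    then show ?thesis
      unfolding F_def 2 3 4 by (simp add: algebra_simps add_divide_distrib diff_divide_distrib)
  next
    case False
    then have "x \<notin> closure {x. \<phi> x \<noteq> 0}" "x \<notin> closure {x. F x \<noteq> 0}"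
      using \<phi>' FS by (auto simp only: C1c_on_def)
    then have "\<phi> x = 0" "grad \<phi> x = 0" "F x = 0" "grad F x = 0"
      by (blast intro: C1c_on_eq_0)+
    then show ?thesis by simp
  qed
  have "integrable lborel (\<lambda>x. x \<bullet> grad F x)"
    using C1c_on_integrable[OF F, of "\<lambda>x. x" "\<lambda>_. 0"] by simp
  moreover have "integrable lborel F"
    using C1c_on_integrable[OF F, of "\<lambda>_. 0" "\<lambda>_. 1"] by simp
  ultimately have "0 = (LINT x|lborel. x \<bullet> grad F x + ?N * F x)"
    by (simp add: C1c_on_Euler_integral[OF F])
  also have "\<dots> = (LINT x|lborel. grad V x \<bullet> grad \<phi> x + ?h x * \<phi> x)"
    by (simp only: pointwise)
  also have "\<dots> = (LINT x|lborel. grad V x \<bullet> grad \<phi> x) + (LINT x|lborel. ?h x * \<phi> x)"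
  proof (rule Bochner_Integration.integral_add)
    show "integrable lborel (\<lambda>x. grad V x \<bullet> grad \<phi> x)"
      using C1c_on_integrable[OF \<phi> C1_on_grad_continuous[OF C1V], of "\<lambda>_. 0"] by simp
    have "continuous_on ?S ?h"
      using S by (intro continuous_intros continuous_on_compose2[OF cont]
          continuous_on_compose2[OF cont'] continuous_on_ln_norm) (auto simp: annulus_def)
    then show "integrable lborel (\<lambda>x. ?h x * \<phi> x)"
      using C1c_on_integrable[OF \<phi>, of "\<lambda>_. 0" ?h] by simp
  qed
  finally show ?thesis unfolding V_def by simp
qed

subsection \<open>Weak form and comparison\<close>

text \<open>A single integral, so that two weak forms can be subtracted under the integral sign and
  the sign of the difference read off pointwise.\<close>

definition weak_form :: "real \<Rightarrow> real \<Rightarrow> real \<Rightarrow> ('a::euclidean_space \<Rightarrow> real) \<Rightarrow> ('a \<Rightarrow> real) \<Rightarrow> real" where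
  "weak_form q \<theta> lam u \<phi> = (LINT x|lborel. grad u x \<bullet> grad \<phi> x
     + (norm x powr \<theta> * u x powr q - lam / (norm x)\<^sup>2 * u x) * \<phi> x)"

lemma weak_form_integrable:
  fixes u :: "'a::euclidean_space \<Rightarrow> real"
  assumes "S \<subseteq> - {0}" "C1_on S u" "\<And>x. x \<in> S \<Longrightarrow> u x > 0" "C1c_on S \<phi>"
  shows "integrable lborel (\<lambda>x. grad u x \<bullet> grad \<phi> x)"
    and "integrable lborel (\<lambda>x. lam / (norm x)\<^sup>2 * u x * \<phi> x)"
    and "integrable lborel (\<lambda>x. norm x powr \<theta> * u x powr q * \<phi> x)"
    and "integrable lborel (\<lambda>x. grad u x \<bullet> grad \<phi> x
     + (norm x powr \<theta> * u x powr q - lam / (norm x)\<^sup>2 * u x) * \<phi> x)"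
proof -
  note u = C1_on_continuous[OF assms(2)] C1_on_grad_continuous[OF assms(2)]
  have 1: "continuous_on S (\<lambda>x. norm x powr \<theta> * u x powr q)"
    using assms u by (intro continuous_intros) (auto simp: less_le)
  have 2: "continuous_on S (\<lambda>x. lam / (norm x)\<^sup>2 * u x)"
    using assms u by (intro continuous_intros) auto
  show "integrable lborel (\<lambda>x. grad u x \<bullet> grad \<phi> x)"
    using C1c_on_integrable[OF assms(4) u(2), of "\<lambda>_. 0"] by simp
  show "integrable lborel (\<lambda>x. lam / (norm x)\<^sup>2 * u x * \<phi> x)"
    using C1c_on_integrable[OF assms(4) continuous_on_const 2, of 0] by simp
  show "integrable lborel (\<lambda>x. norm x powr \<theta> * u x powr q * \<phi> x)"
    using C1c_on_integrable[OF assms(4) continuous_on_const 1, of 0] by simp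
  show "integrable lborel (\<lambda>x. grad u x \<bullet> grad \<phi> x
     + (norm x powr \<theta> * u x powr q - lam / (norm x)\<^sup>2 * u x) * \<phi> x)"
    by (intro C1c_on_integrable[OF assms(4) u(2)] continuous_on_diff 1 2)
qed

lemma weak_form_split:
  fixes u :: "'a::euclidean_space \<Rightarrow> real"
  assumes "S \<subseteq> - {0}" "C1_on S u" "\<And>x. x \<in> S \<Longrightarrow> u x > 0" "C1c_on S \<phi>"
  shows "(LINT x|lborel. grad u x \<bullet> grad \<phi> x)
        - (LINT x|lborel. lam / (norm x)\<^sup>2 * u x * \<phi> x)
        + (LINT x|lborel. norm x powr \<theta> * u x powr q * \<phi> x) = weak_form q \<theta> lam u \<phi>"
proof -
  note int = weak_form_integrable[OF assms]
  have "(LINT x|lborel. grad u x \<bullet> grad \<phi> x)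
        - (LINT x|lborel. lam / (norm x)\<^sup>2 * u x * \<phi> x)
        + (LINT x|lborel. norm x powr \<theta> * u x powr q * \<phi> x)
      = (LINT x|lborel. grad u x \<bullet> grad \<phi> x - lam / (norm x)\<^sup>2 * u x * \<phi> x
          + norm x powr \<theta> * u x powr q * \<phi> x)"
    using int(1-3) by (simp only: Bochner_Integration.integral_add Bochner_Integration.integral_diff
        Bochner_Integration.integrable_diff)
  also have "\<dots> = weak_form q \<theta> lam u \<phi>"
    unfolding weak_form_def by (rule arg_cong[where f = "integral\<^sup>L lborel"]) (auto simp: algebra_simps)
  finally show ?thesis .
qed

lemma is_solution_iff_weak_form:
  "is_solution q \<theta> lam u \<longleftrightarrow> C1_on (- {0}) u \<and> (\<forall>x\<in>- {0}. u x > 0) \<and>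
     (\<forall>\<phi>. C1c_on (- {0}) \<phi> \<longrightarrow> weak_form q \<theta> lam u \<phi> = 0)"
  unfolding is_solution_def using weak_form_split[of "- {0}" u _ lam \<theta> q] by auto

lemma not_AE_notin_open:
  fixes U :: "'a::euclidean_space set"
  assumes "open U" "U \<noteq> {}"
  shows "\<not> (AE x in lborel. x \<notin> U)"
proof
  assume "AE x in lborel. x \<notin> U"
  then have "U \<in> null_sets lborel" using assms(1) by (simp add: AE_iff_null_sets)
  then have "negligible U" by (simp add: negligible_iff_null_sets null_sets_completionI)
  then show False using assms open_not_negligible by blast
qed

text \<open>Brezis-Oswald: testing \<open>v\<close> against \<open>u \<psi>\<close> and \<open>u\<close> against \<open>v \<psi>\<close>, with
  \<open>\<psi> = ((v/u - 1)\<^sup>+)\<^sup>2\<close>, cancels the singular potential, and what remains of the two gradient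
  terms is \<open>2 u\<^sup>2 (v/u - 1)\<^sup>+ |\<nabla>(v/u)|\<^sup>2\<close>. The square makes \<open>\<psi>\<close> continuously differentiable.\<close>

lemma weak_comparison:
  fixes u v :: "'a::euclidean_space \<Rightarrow> real"
  assumes \<Omega>: "open \<Omega>" "\<Omega> \<subseteq> - {0}" and "q > 1"
    and u: "C1_on \<Omega> u" "\<And>x. x \<in> \<Omega> \<Longrightarrow> u x > 0"
    and v: "C1_on \<Omega> v" "\<And>x. x \<in> \<Omega> \<Longrightarrow> v x > 0"
    and K: "compact K" "K \<subseteq> \<Omega>" "\<And>x. x \<in> \<Omega> - K \<Longrightarrow> v x \<le> u x"
    and super: "\<And>\<phi>. C1c_on \<Omega> \<phi> \<Longrightarrow> (\<And>x. \<phi> x \<ge> 0) \<Longrightarrow> weak_form q \<theta> lam u \<phi> \<ge> 0"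
    and sub: "\<And>\<phi>. C1c_on \<Omega> \<phi> \<Longrightarrow> (\<And>x. \<phi> x \<ge> 0) \<Longrightarrow> weak_form q \<theta> lam v \<phi> \<le> 0"
    and x: "x \<in> \<Omega>"
  shows "v x \<le> u x"
proof (rule ccontr)
  assume "\<not> v x \<le> u x"
  define r where "r x = v x * inverse (u x) - 1" for x
  define R where "R x = v x *\<^sub>R (- (inverse (u x))\<^sup>2 *\<^sub>R grad u x) + inverse (u x) *\<^sub>R grad v x" for x
  \<comment> \<open>\<open>u\<close> and \<open>v\<close> are controlled on \<open>\<Omega>\<close>
    only, hence the extension by zero; \<open>v \<le> u\<close> off \<open>K\<close> puts the
    support of \<open>\<psi>\<close> inside \<open>K\<close>.\<close>
  define \<psi> where "\<psi> x = (if x \<in> \<Omega> then (max 0 (r x))\<^sup>2 else 0)" for x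
  have r_pos: "r x > 0 \<longleftrightarrow> v x > u x" if "x \<in> \<Omega>" for x
    using u(2)[OF that] by (simp add: r_def field_simps)
  have r: "GDERIV r x :> R x" if "x \<in> \<Omega>" for x
  proof -
    have "GDERIV (\<lambda>x. v x * inverse (u x) - 1) x :> R x - 0"
      unfolding R_def using that u(2)[OF that]
      by (intro GDERIV_diff GDERIV_mult GDERIV_inverse GDERIV_const C1_on_GDERIV[OF u(1)]
          C1_on_GDERIV[OF v(1)]) auto
    then show ?thesis unfolding r_def by simp
  qed
  have sq: "DERIV (\<lambda>s::real. (max 0 s)\<^sup>2) s :> 2 * max 0 s" for s
  proof (cases s "0::real" rule: linorder_cases)
    case less
    have "((\<lambda>s::real. (max 0 s)\<^sup>2) has_field_derivative 0) (at s)"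
      by (rule has_field_derivative_transform_within_open[OF DERIV_const, of "{..<0}"])
        (use less in auto)
    then show ?thesis using less by simp
  next
    case greater
    have "((\<lambda>s::real. s\<^sup>2) has_field_derivative 2 * s) (at s)"
      by (auto intro!: derivative_eq_intros)
    then have "((\<lambda>s::real. (max 0 s)\<^sup>2) has_field_derivative 2 * s) (at s)"
      by (rule has_field_derivative_transform_within_open[of _ _ _ "{0<..}"])
        (use greater in auto)
    then show ?thesis using greater by simp
  next
    case equal
    have "((\<lambda>h. (max 0 h)\<^sup>2 / h) \<longlongrightarrow> (0::real)) (at 0)"
    proof (rule Lim_null_comparison)
      show "\<forall>\<^sub>F h in at 0. norm ((max 0 h)\<^sup>2 / h) \<le> \<bar>h::real\<bar>"
        by (intro always_eventually) (auto simp: max_def power2_eq_square)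
      show "((\<lambda>h::real. \<bar>h\<bar>) \<longlongrightarrow> 0) (at 0)" by (intro tendsto_eq_intros) auto
    qed
    then show ?thesis using equal by (simp add: DERIV_def)
  qed
  have \<psi>g: "GDERIV \<psi> x :> (2 * max 0 (r x)) *\<^sub>R R x" if "x \<in> \<Omega>" for x
  proof -
    have "GDERIV (\<lambda>x. (max 0 (r x))\<^sup>2) x :> (2 * max 0 (r x)) *\<^sub>R R x"
      by (rule GDERIV_DERIV_compose[OF r[OF that] sq])
    then show ?thesis unfolding gderiv_def
      by (rule has_derivative_transform_within_open[OF _ \<Omega>(1) that]) (simp add: \<psi>_def)
  qed
  have "continuous_on \<Omega> (\<lambda>x. (2 * max 0 (r x)) *\<^sub>R R x)"
    unfolding r_def R_def using u v
    by (intro continuous_intros C1_on_continuous[OF u(1)] C1_on_continuous[OF v(1)]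
        C1_on_grad_continuous[OF u(1)] C1_on_grad_continuous[OF v(1)]) (auto simp: less_le)
  then have \<psi>C1: "C1_on \<Omega> \<psi>" using C1_onI[OF \<psi>g] by blast
  have "{x. \<psi> x \<noteq> 0} \<subseteq> K"
    proof
    fix x assume "x \<in> {x. \<psi> x \<noteq> 0}"
    then have "x \<in> \<Omega>" "r x > 0" by (auto simp: \<psi>_def max_def split: if_splits)
    then show "x \<in> K" using K(3)[of x] r_pos[of x] by auto
  qed
  then have clK: "closure {x. \<psi> x \<noteq> 0} \<subseteq> K"
    by (rule closure_minimal[OF _ compact_imp_closed[OF K(1)]])
  then have "compact (closure {x. \<psi> x \<noteq> 0})"
    using K(1) compact_Int_closed[of K "closure {x. \<psi> x \<noteq> 0}"] by (simp only: Int_absorb1 closed_closure)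
  then have \<psi>: "C1c_on \<Omega> \<psi>" using \<psi>C1 clK K(2) unfolding C1c_on_def by blast
  let ?e = "\<lambda>u \<phi> x. grad u x \<bullet> grad \<phi> x
     + (norm x powr \<theta> * u x powr q - lam / (norm x)\<^sup>2 * u x) * \<phi> x"
  define \<phi>1 where "\<phi>1 x = u x * \<psi> x" for x
  define \<phi>2 where "\<phi>2 x = v x * \<psi> x" for x
  have \<phi>: "C1c_on \<Omega> \<phi>1" "C1c_on \<Omega> \<phi>2"
    unfolding \<phi>1_def \<phi>2_def by (rule C1c_on_mult[OF \<psi> u(1)] C1c_on_mult[OF \<psi> v(1)])+
  have \<psi>0: "\<psi> x = 0" if "x \<notin> \<Omega>" for x using that by (simp add: \<psi>_def)
  have \<phi>nonneg: "\<phi>1 x \<ge> 0" "\<phi>2 x \<ge> 0" for x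
    using u(2)[of x] v(2)[of x] by (auto simp: \<phi>1_def \<phi>2_def \<psi>_def)
  \<comment> \<open>The integral of \<open>D\<close> is at most zero by the sub- and supersolution
    hypotheses, while \<open>D\<close> is pointwise nonnegative; hence it vanishes almost
    everywhere.\<close>
  define D where "D x = ?e v \<phi>1 x - ?e u \<phi>2 x" for x
  have int: "integrable lborel (?e v \<phi>1)" "integrable lborel (?e u \<phi>2)"
    using weak_form_integrable(4)[OF \<Omega>(2) v \<phi>(1), of \<theta> q lam]
      weak_form_integrable(4)[OF \<Omega>(2) u \<phi>(2), of \<theta> q lam] by blast+
  have "(LINT x|lborel. D x) = weak_form q \<theta> lam v \<phi>1 - weak_form q \<theta> lam u \<phi>2"
    unfolding D_def weak_form_def using int by (rule Bochner_Integration.integral_diff)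
  then have le: "(LINT x|lborel. D x) \<le> 0"
    using super[OF \<phi>(2) \<phi>nonneg(2)] sub[OF \<phi>(1) \<phi>nonneg(1)] by linarith
  have D_eq: "D x = 2 * max 0 (r x) * (u x)\<^sup>2 * (R x \<bullet> R x)
      + norm x powr \<theta> * (v x powr q * u x - u x powr q * v x) * \<psi> x" if "x \<in> \<Omega>" for x
  proof -
    have 1: "grad \<phi>1 x = u x *\<^sub>R grad \<psi> x + \<psi> x *\<^sub>R grad u x"
      unfolding \<phi>1_def by (rule grad_mult[OF u(1) \<psi>C1 that])
    have 2: "grad \<phi>2 x = v x *\<^sub>R grad \<psi> x + \<psi> x *\<^sub>R grad v x"
      unfolding \<phi>2_def by (rule grad_mult[OF v(1) \<psi>C1 that])
    have 3: "grad \<psi> x = (2 * max 0 (r x)) *\<^sub>R R x" by (rule grad_eqI[OF \<psi>g[OF that]])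
    \<comment> \<open>The quotient rule solved for the cross term: it becomes a multiple of the
      gradient of \<open>v / u\<close>, so that its product with the gradient of
      \<open>\<psi>\<close> is a nonnegative multiple of a square.\<close>
    have 4: "u x *\<^sub>R grad v x - v x *\<^sub>R grad u x = (u x)\<^sup>2 *\<^sub>R R x"
      using u(2)[OF that] by (simp add: R_def scaleR_right_distrib power2_eq_square field_simps)
    have "D x = (u x *\<^sub>R grad v x - v x *\<^sub>R grad u x) \<bullet> grad \<psi> x
      + norm x powr \<theta> * (v x powr q * u x - u x powr q * v x) * \<psi> x"
      unfolding D_def 1 2 \<phi>1_def \<phi>2_def
      by (simp add: inner_add_right inner_diff_left inner_commute algebra_simps)
    also have "(u x *\<^sub>R grad v x - v x *\<^sub>R grad u x) \<bullet> grad \<psi> x = 2 * max 0 (r x) * (u x)\<^sup>2 * (R x \<bullet> R x)"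
      unfolding 3 4 by simp
    finally show ?thesis .
  qed
  have D_pos: "D x > 0" if "x \<in> \<Omega>" "v x > u x" for x
  proof -
    have pos: "u x > 0" "v x > 0" "r x > 0" "\<psi> x > 0" "norm x > 0"
      using u v that r_pos[OF that(1)] \<Omega>(2) by (auto simp: \<psi>_def)
    \<comment> \<open>Here \<open>q > 1\<close> acts: absorption divided by the solution is strictly
      increasing, which makes \<open>D\<close> strictly positive wherever
      \<open>v > u\<close>.\<close>
    have "u x powr (q - 1) < v x powr (q - 1)"
      using pos that \<open>q > 1\<close> by (intro powr_less_mono2) auto
    then have "u x powr (q - 1) * (u x * v x) < v x powr (q - 1) * (u x * v x)"
      using pos by simp
    moreover have "y powr q = y powr (q - 1) * y" if "y > 0" for y :: real
      using that powr_add[of y "q - 1" 1] by simp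
    ultimately have "u x powr q * v x < v x powr q * u x"
      using pos by (simp add: mult.assoc mult.commute[of "v x" "u x"])
    then show ?thesis using pos unfolding D_eq[OF that(1)]
      by (intro add_nonneg_pos mult_pos_pos) simp_all
  qed
  have D_nonneg: "D x \<ge> 0" for x
  proof (cases "x \<in> \<Omega> \<and> v x > u x")
    case True
    then show ?thesis using D_pos by (simp add: less_imp_le)
  next
    case False
    show ?thesis
    proof (cases "x \<in> \<Omega>")
      case True
      then have "max 0 (r x) = 0" using False r_pos[OF True] by (simp add: max_def)
      then show ?thesis using D_eq[OF True] True by (simp add: \<psi>_def)
    next
      case False
      then have "x \<notin> closure {x. \<phi>1 x \<noteq> 0}" "x \<notin> closure {x. \<phi>2 x \<noteq> 0}"
        using \<phi> by (auto simp only: C1c_on_def)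
      then show ?thesis
        using C1c_on_eq_0(1,3)[of x \<phi>1] C1c_on_eq_0(1,3)[of x \<phi>2] by (simp add: D_def)
    qed
  qed
  have intD: "integrable lborel D"
    unfolding D_def using int by (rule Bochner_Integration.integrable_diff)
  have "(LINT x|lborel. D x) = 0"
    by (intro antisym le Bochner_Integration.integral_nonneg D_nonneg)
  then have "AE x in lborel. D x = 0"
    using integral_nonneg_eq_0_iff_AE[OF intD] D_nonneg by simp
  \<comment> \<open>The set where \<open>v > u\<close> is null by the strict sign of
    \<open>D\<close> and open by continuity, yet it contains the assumed counterexample.\<close>
  then have "AE x in lborel. x \<notin> {x \<in> \<Omega>. 0 < v x - u x}"
    by (rule AE_mp) (auto intro!: AE_I2 dest: D_pos)
  moreover have "open {x \<in> \<Omega>. 0 < v x - u x}"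
  proof -
    have "continuous_on \<Omega> (\<lambda>x. v x - u x)"
      by (intro continuous_intros C1_on_continuous[OF u(1)] C1_on_continuous[OF v(1)])
    then have "open ((\<lambda>x. v x - u x) -` {0<..} \<inter> \<Omega>)"
      using continuous_on_open_vimage[OF \<Omega>(1)] open_greaterThan by blast
    then show ?thesis by (simp add: vimage_def Int_def conj_commute)
  qed
  moreover have "x \<in> {x \<in> \<Omega>. 0 < v x - u x}" using \<open>\<not> v x \<le> u x\<close> x by simp
  ultimately show False using not_AE_notin_open by blast
qed

subsection \<open>Radial barriers\<close>

lemma GDERIV_cong_open:
  assumes "open S" "x \<in> S" "\<And>y. y \<in> S \<Longrightarrow> f y = g y"
  shows "(GDERIV f x :> D) = (GDERIV g x :> D)"
  unfolding gderiv_def using has_derivative_transform_within_open[OF _ assms(1,2)] assms(3) by metis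

lemma grad_cong:
  assumes "open S" "x \<in> S" "\<And>y. y \<in> S \<Longrightarrow> f y = g y"
  shows "grad f x = grad g x"
  using GDERIV_cong_open[OF assms] by (simp add: grad_def)

lemma C1_on_cong:
  assumes "open S" "C1_on S f" "\<And>y. y \<in> S \<Longrightarrow> f y = g y"
  shows "C1_on S g"
proof (rule C1_onI)
  show "GDERIV g x :> grad f x" if "x \<in> S" for x
    using GDERIV_cong_open[of S x f g "grad f x"] C1_on_GDERIV[OF assms(2) that] that assms by blast
  show "continuous_on S (grad f)" by (rule C1_on_grad_continuous[OF assms(2)])
qed

text \<open>Allows \<open>U0\<close>, written with \<open>powr\<close>, to be exchanged for its
  exponential form, although agreement is available only off the origin.\<close>

lemma weak_form_cong:
  fixes u v :: "'a::euclidean_space \<Rightarrow> real"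
  assumes "open S" "C1c_on S \<phi>" "\<And>x. x \<in> S \<Longrightarrow> u x = v x"
  shows "weak_form q \<theta> lam u \<phi> = weak_form q \<theta> lam v \<phi>"
proof -
  have grad: "grad u x = grad v x" if "x \<in> S" for x
    using grad_cong[OF assms(1) that] assms(3) by blast
  have "grad u x \<bullet> grad \<phi> x + (norm x powr \<theta> * u x powr q - lam / (norm x)\<^sup>2 * u x) * \<phi> x
    = grad v x \<bullet> grad \<phi> x + (norm x powr \<theta> * v x powr q - lam / (norm x)\<^sup>2 * v x) * \<phi> x" for x
  proof (cases "x \<in> S")
    case True then show ?thesis by (simp only: grad assms(3))
  next
    case False
    then have "x \<notin> closure {x. \<phi> x \<noteq> 0}" using assms(2) by (auto simp only: C1c_on_def)
    then have "\<phi> x = 0" "grad \<phi> x = 0" by (blast intro: C1c_on_eq_0)+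
    then show ?thesis by simp
  qed
  then show ?thesis unfolding weak_form_def by presburger
qed

lemma powr_diff_one: "x > 0 \<Longrightarrow> x powr q = x powr (q - 1) * (x::real)"
  using powr_add[of x "q - 1" 1] by simp

text \<open>\<open>U0\<close> on an arbitrary Euclidean space. With \<open>exp\<close> in place of
  \<open>powr\<close> it has the form \<open>H (ln |x|)\<close> that the radial lemmas require, and
  for positive \<open>ell\<close> it is positive even at the origin.\<close>

definition U_ext :: "real \<Rightarrow> real \<Rightarrow> real \<Rightarrow> 'a::euclidean_space \<Rightarrow> real" where
  "U_ext q \<theta> lam x = ell DIM('a) q \<theta> lam powr (1 / (q - 1)) * exp (- Theta q \<theta> * ln (norm x))"

definition barrier :: "real \<Rightarrow> real \<Rightarrow> real \<Rightarrow> (real \<Rightarrow> real) \<Rightarrow> 'a::euclidean_space \<Rightarrow> real" where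
  "barrier q \<theta> lam W x = U_ext q \<theta> lam x * W (ln (norm x))"

text \<open>The equation for \<open>U\<^sub>0(x) W(ln |x|)\<close> is autonomous in \<open>t = ln |x|\<close>, up to a positive factor.\<close>

definition profile_op :: "nat \<Rightarrow> real \<Rightarrow> real \<Rightarrow> real \<Rightarrow> real \<Rightarrow> real \<Rightarrow> real \<Rightarrow> real" where
  "profile_op N q \<theta> lam w w' w'' =
     ell N q \<theta> lam * (w powr q - w) + (2 * Theta q \<theta> - (real N - 2)) * w' - w''"

lemma barrier_C1_on:
  assumes "\<And>t. t \<in> T \<Longrightarrow> DERIV W t :> W' t" "continuous_on T W'"
  shows "C1_on (annulus T) (barrier q \<theta> lam W)"
proof -
  let ?C = "ell DIM('a) q \<theta> lam powr (1 / (q - 1))" and ?\<Theta> = "Theta q \<theta>"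
  have "continuous_on T W" using assms(1) by (meson DERIV_isCont continuous_at_imp_continuous_on)
  then have "continuous_on T (\<lambda>t. ?C * exp (- ?\<Theta> * t) * (W' t - ?\<Theta> * W t))"
    using assms(2) by (intro continuous_intros)
  moreover have "DERIV (\<lambda>t. ?C * exp (- ?\<Theta> * t) * W t) t :> ?C * exp (- ?\<Theta> * t) * (W' t - ?\<Theta> * W t)"
    if "t \<in> T" for t
    using that by (auto intro!: derivative_eq_intros assms(1) simp: algebra_simps)
  ultimately have "C1_on (annulus T) (\<lambda>x::'a. ?C * exp (- ?\<Theta> * ln (norm x)) * W (ln (norm x)))"
    by (intro C1_on_radial[where H = "\<lambda>t. ?C * exp (- ?\<Theta> * t) * W t"])
  then show ?thesis by (simp add: barrier_def[abs_def] U_ext_def)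
qed

text \<open>All terms share one factor: \<open>exp (- 2 t) exp (- \<Theta> t)\<close> from the
  linear part and \<open>exp ((\<theta> - \<Theta> q) t)\<close> from the absorption agree by the
  choice of \<open>\<Theta>\<close>, and the constant satisfies \<open>C powr q = C l\<close>. A
  pointwise sign of \<open>profile_op\<close> thus passes to the weak form on nonnegative test
  functions.\<close>

lemma barrier_weak_form:
  fixes \<phi> :: "'a::euclidean_space \<Rightarrow> real"
  assumes T: "open T" and q: "q > 1" and l: "ell DIM('a) q \<theta> lam > 0"
    and W: "\<And>t. t \<in> T \<Longrightarrow> DERIV W t :> W' t" "\<And>t. t \<in> T \<Longrightarrow> DERIV W' t :> W'' t"
      "continuous_on T W''" "\<And>t. t \<in> T \<Longrightarrow> W t > 0"
    and \<phi>: "C1c_on (annulus T) \<phi>"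
  shows "weak_form q \<theta> lam (barrier q \<theta> lam W) \<phi> =
    (LINT x|lborel. ell DIM('a) q \<theta> lam powr (1 / (q - 1)) * exp (- (Theta q \<theta> + 2) * ln (norm x))
       * profile_op DIM('a) q \<theta> lam (W (ln (norm x))) (W' (ln (norm x))) (W'' (ln (norm x))) * \<phi> x)"
proof -
  define \<Theta> where "\<Theta> = Theta q \<theta>"
  define l where "l = ell DIM('a) q \<theta> lam"
  define C where "C = l powr (1 / (q - 1))"
  define V where "V = (barrier q \<theta> lam W :: 'a \<Rightarrow> real)"
  define H where "H t = C * exp (- \<Theta> * t) * W t" for t
  define H' where "H' t = C * exp (- \<Theta> * t) * (W' t - \<Theta> * W t)" for t
  define H'' where "H'' t = C * exp (- \<Theta> * t) * (W'' t - 2 * \<Theta> * W' t + \<Theta>\<^sup>2 * W t)" for t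
  let ?S = "annulus T :: 'a set" and ?N = "real DIM('a)"
  let ?h = "\<lambda>x. (H'' (ln (norm x)) + (?N - 2) * H' (ln (norm x))) / (norm x)\<^sup>2"
  let ?g = "\<lambda>x. norm x powr \<theta> * V x powr q - lam / (norm x)\<^sup>2 * V x"
  have S: "open ?S" "?S \<subseteq> - {0}" using T annulus_subset by (auto intro: open_annulus)
  have l0: "l > 0" and C0: "C > 0" using l by (simp_all add: l_def C_def)
  have Vdef: "V = (\<lambda>x. H (ln (norm x)))"
    by (simp add: V_def H_def barrier_def[abs_def] U_ext_def C_def l_def \<Theta>_def)
  have H: "DERIV H t :> H' t" "DERIV H' t :> H'' t" if "t \<in> T" for t
    unfolding H_def H'_def H''_def using that
    by (auto intro!: derivative_eq_intros W simp: algebra_simps power2_eq_square)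
  have contW: "continuous_on T W" "continuous_on T W'"
    using W(1,2) by (meson DERIV_isCont continuous_at_imp_continuous_on)+
  then have contH: "continuous_on T H''" "continuous_on T H'"
    unfolding H''_def H'_def using W(3) by (auto intro!: continuous_intros)
  have V: "C1_on ?S V" unfolding V_def by (rule barrier_C1_on[OF W(1) contW(2)])
  have Vpos: "V x > 0" if "x \<in> ?S" for x
    using W(4) l that by (simp add: V_def barrier_def U_ext_def annulus_def)
  note int = weak_form_integrable[OF S(2) V Vpos \<phi>]
  have "continuous_on ?S ?h"
    using S by (intro continuous_intros continuous_on_compose2[OF contH(1)]
        continuous_on_compose2[OF contH(2)] continuous_on_ln_norm) (auto simp: annulus_def)
  then have inth: "integrable lborel (\<lambda>x. ?h x * \<phi> x)"
    using C1c_on_integrable[OF \<phi> continuous_on_const, of ?h 0] by simp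
  have intg: "integrable lborel (\<lambda>x. ?g x * \<phi> x)"
    unfolding left_diff_distrib using int(2,3) by (rule Bochner_Integration.integrable_diff[rotated])
  have "weak_form q \<theta> lam V \<phi> = (LINT x|lborel. grad V x \<bullet> grad \<phi> x) + (LINT x|lborel. ?g x * \<phi> x)"
    unfolding weak_form_def using int(1) intg by (rule Bochner_Integration.integral_add)
  also have "(LINT x|lborel. grad V x \<bullet> grad \<phi> x) = - (LINT x|lborel. ?h x * \<phi> x)"
    unfolding Vdef by (rule radial_integral_by_parts[OF T H contH(1) \<phi>])
  also have "- (LINT x|lborel. ?h x * \<phi> x) + (LINT x|lborel. ?g x * \<phi> x)
      = (LINT x|lborel. ?g x * \<phi> x - ?h x * \<phi> x)"
    using inth intg by simp
  also have "\<dots> = (LINT x|lborel. C * exp (- (\<Theta> + 2) * ln (norm x))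
       * profile_op DIM('a) q \<theta> lam (W (ln (norm x))) (W' (ln (norm x))) (W'' (ln (norm x))) * \<phi> x)"
  proof (rule arg_cong[where f = "integral\<^sup>L lborel"], rule ext)
    fix x
    show "?g x * \<phi> x - ?h x * \<phi> x = C * exp (- (\<Theta> + 2) * ln (norm x))
       * profile_op DIM('a) q \<theta> lam (W (ln (norm x))) (W' (ln (norm x))) (W'' (ln (norm x))) * \<phi> x"
    proof (cases "x \<in> ?S")
      case True
      define t where "t = ln (norm x)"
      have t: "t \<in> T" and x: "norm x = exp t" using True by (auto simp: annulus_def t_def)
      define w where "w = W t"
      have w: "w > 0" using W(4)[OF t] by (simp add: w_def)
      define e where "e = exp (- (\<Theta> + 2) * t)"
      have sq: "1 / (norm x)\<^sup>2 = exp (- 2 * t)"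
        by (simp add: x exp_minus exp_double inverse_eq_divide)
      have e: "exp (- 2 * t) * exp (- \<Theta> * t) = e"
        by (simp add: e_def exp_add[symmetric] algebra_simps)
      have Vx: "V x = C * exp (- \<Theta> * t) * w" by (simp add: Vdef H_def t_def w_def)
      have Cq: "C powr q = C * l"
      proof -
        have "C powr (q - 1) = l" using q l0 by (simp add: C_def powr_powr)
        then show ?thesis using powr_diff_one[OF C0, of q] by simp
      qed
      have \<Theta>q: "\<theta> - \<Theta> * q = - (\<Theta> + 2)" using q by (simp add: \<Theta>_def Theta_def field_simps)
      have "norm x powr \<theta> * V x powr q = exp (\<theta> * t) * (C powr q * exp (- \<Theta> * t) powr q * w powr q)"
      proof -
        have "norm x powr \<theta> = exp (\<theta> * t)" by (simp add: x powr_def)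
        moreover have "V x powr q = C powr q * exp (- \<Theta> * t) powr q * w powr q"
          unfolding Vx using C0 w by (simp only: powr_mult)
        ultimately show ?thesis by simp
      qed
      also have "\<dots> = C * l * w powr q * exp ((\<theta> - \<Theta> * q) * t)"
        by (simp add: Cq exp_powr_real exp_add[symmetric] algebra_simps)
      finally have 1: "norm x powr \<theta> * V x powr q = C * e * (l * w powr q)"
        unfolding \<Theta>q e_def by (simp add: algebra_simps)
      have 2: "lam / (norm x)\<^sup>2 * V x = C * e * (lam * w)"
      proof -
        have "lam / (norm x)\<^sup>2 * V x = lam * (1 / (norm x)\<^sup>2) * V x" by simp
        also have "\<dots> = C * (exp (- 2 * t) * exp (- \<Theta> * t)) * (lam * w)"
          unfolding sq Vx by (simp only: ac_simps)
        finally show ?thesis unfolding e .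
      qed
      have 3: "?h x = C * e * (W'' t - 2 * \<Theta> * W' t + \<Theta>\<^sup>2 * w + (?N - 2) * (W' t - \<Theta> * w))"
      proof -
        have "?h x = 1 / (norm x)\<^sup>2 * (H'' t + (?N - 2) * H' t)" by (simp add: t_def)
        also have "\<dots> = C * (exp (- 2 * t) * exp (- \<Theta> * t))
            * (W'' t - 2 * \<Theta> * W' t + \<Theta>\<^sup>2 * w + (?N - 2) * (W' t - \<Theta> * w))"
          unfolding sq H''_def H'_def w_def by (simp only: algebra_simps)
        finally show ?thesis unfolding e .
      qed
      have "l * w powr q - lam * w - (W'' t - 2 * \<Theta> * W' t + \<Theta>\<^sup>2 * w + (?N - 2) * (W' t - \<Theta> * w))
          = profile_op DIM('a) q \<theta> lam w (W' t) (W'' t)"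
        unfolding profile_op_def l_def[symmetric] \<Theta>_def[symmetric]
        unfolding l_def ell_def \<Theta>_def[symmetric] by (simp add: algebra_simps)
      then have "?g x - ?h x = C * e * profile_op DIM('a) q \<theta> lam w (W' t) (W'' t)"
        unfolding 1 2 3 by (simp only: right_diff_distrib[symmetric])
      then show ?thesis
        unfolding left_diff_distrib[symmetric] by (simp only: e_def w_def t_def)
    next
      case False
      then have "x \<notin> closure {x. \<phi> x \<noteq> 0}" using \<phi> by (auto simp only: C1c_on_def)
      then have "\<phi> x = 0" by (rule C1c_on_eq_0(1))
      then show ?thesis by simp
    qed
  qed
  finally show ?thesis unfolding V_def C_def l_def \<Theta>_def .
qed

text \<open>Supplies the compact set of the comparison: strict inequality on both boundary spheres
  keeps the contact set away from them.\<close>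

lemma compact_contact_set:
  fixes f g :: "'a::euclidean_space \<Rightarrow> real"
  assumes "continuous_on (annulus {a..c}) f" "continuous_on (annulus {a..c}) g"
    and "\<And>x. x \<in> annulus {a, c} \<Longrightarrow> f x < g x"
  defines "K \<equiv> {x \<in> annulus {a..c}. g x \<le> f x}"
  shows "compact K" "K \<subseteq> annulus {a<..<c}"
proof -
  let ?A = "annulus {a..c} :: 'a set"
  have "closed (?A \<inter> (\<lambda>x. f x - g x) -` {0..})"
    using assms(1,2) by (intro continuous_closed_preimage continuous_on_diff
        compact_imp_closed[OF compact_annulus] closed_atLeast)
  moreover have "K = ?A \<inter> (\<lambda>x. f x - g x) -` {0..}" by (auto simp: K_def)
  ultimately show "compact K"
    using compact_Int_closed[OF compact_annulus, of "?A \<inter> (\<lambda>x. f x - g x) -` {0..}" a c]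
    by (simp only: Int_left_absorb)
  show "K \<subseteq> annulus {a<..<c}"
  proof
    fix x assume x: "x \<in> K"
    then have "x \<notin> annulus {a, c}" using assms(3)[of x] by (auto simp: K_def)
    then show "x \<in> annulus {a<..<c}" using x by (auto simp: K_def annulus_def less_le)
  qed
qed

lemma continuous_on_barrier:
  assumes "S \<subseteq> annulus T" "continuous_on T W"
  shows "continuous_on S (barrier q \<theta> lam W)"
  unfolding barrier_def[abs_def] U_ext_def using assms
  by (intro continuous_intros continuous_on_compose2[OF assms(2)] continuous_on_ln_norm)
    (auto simp: annulus_def)

section \<open>Comparison of a solution with a radial barrier\<close>

locale positive_solution =
  fixes q \<theta> lam :: real and u :: "'a::euclidean_space \<Rightarrow> real"
  assumes q: "q > 1" and lam: "lam > lambda_H DIM('a)"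
    and C1: "C1_on (- {0}) u" and pos: "\<And>x. x \<noteq> 0 \<Longrightarrow> u x > 0"
    and weak: "\<And>\<phi>. C1c_on (- {0}) \<phi> \<Longrightarrow> weak_form q \<theta> lam u \<phi> = 0"
begin

abbreviation "U \<equiv> (U_ext q \<theta> lam :: 'a \<Rightarrow> real)"

lemma ell_DIM_pos: "ell DIM('a) q \<theta> lam > 0" by (rule ell_pos[OF lam])

lemma U_pos: "U x > 0" using ell_DIM_pos by (simp add: U_ext_def)

lemma solution_properties:
  shows "C1_on (annulus T) u" "continuous_on (annulus T) u" "\<And>x. x \<in> annulus T \<Longrightarrow> u x > 0"
    "open T \<Longrightarrow> C1c_on (annulus T) \<phi> \<Longrightarrow> weak_form q \<theta> lam u \<phi> = 0"
proof -
  show 1: "C1_on (annulus T) u" by (rule C1_on_subset[OF C1 annulus_subset])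
  show "continuous_on (annulus T) u" by (rule C1_on_continuous[OF 1])
  show "u x > 0" if "x \<in> annulus T" for x using that by (simp add: annulus_def pos)
  show "weak_form q \<theta> lam u \<phi> = 0" if "open T" "C1c_on (annulus T) \<phi>"
    by (rule weak[OF C1c_on_extend[OF that(2) open_annulus[OF that(1)] annulus_subset]])
qed

text \<open>The sign of \<open>profile_op\<close> makes the barrier a weak subsolution.
  \<open>W\<close> has to be positive and differentiable only inside the interval and merely
  continuous up to its ends, so a barrier may vanish there.\<close>

lemma barrier_le_solution:
  assumes W: "\<And>t. t \<in> {a<..<c} \<Longrightarrow> DERIV W t :> W' t" "\<And>t. t \<in> {a<..<c} \<Longrightarrow> DERIV W' t :> W'' t"
      "continuous_on {a<..<c} W''" "\<And>t. t \<in> {a<..<c} \<Longrightarrow> W t > 0" "continuous_on {a..c} W"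
    and sub: "\<And>t. t \<in> {a<..<c} \<Longrightarrow> profile_op DIM('a) q \<theta> lam (W t) (W' t) (W'' t) \<le> 0"
    and bd: "\<And>x. x \<in> annulus {a, c} \<Longrightarrow> U x * W (ln (norm x)) < u x"
    and x: "x \<in> annulus {a<..<c}"
  shows "U x * W (ln (norm x)) \<le> u x"
proof -
  let ?T = "{a<..<c}" and ?V = "barrier q \<theta> lam W :: 'a \<Rightarrow> real"
  let ?K = "{x \<in> annulus {a..c}. u x \<le> ?V x}"
  have contW': "continuous_on ?T W'"
    using W(2) by (meson DERIV_isCont continuous_at_imp_continuous_on)
  have K: "compact ?K" "?K \<subseteq> annulus ?T"
    using compact_contact_set[of a c ?V u, OF continuous_on_barrier[OF subset_refl W(5)]
        solution_properties(2)] bd unfolding barrier_def by blast+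
  have "?V x \<le> u x"
  proof (rule weak_comparison[OF open_annulus annulus_subset q solution_properties(1,3)
        barrier_C1_on[OF W(1) contW'] _ K _ _ _ x])
    show "?V x > 0" if "x \<in> annulus ?T" for x
      using U_pos[of x] W(4) that by (simp add: barrier_def annulus_def)
    show "?V x \<le> u x" if "x \<in> annulus ?T - ?K" for x
      using that by (auto simp: annulus_def)
    show "weak_form q \<theta> lam u \<phi> \<ge> 0" if "C1c_on (annulus ?T) \<phi>" for \<phi>
      using solution_properties(4)[OF _ that] by simp
    show "weak_form q \<theta> lam ?V \<phi> \<le> 0" if \<phi>: "C1c_on (annulus ?T) \<phi>" "\<And>x. \<phi> x \<ge> 0" for \<phi>
    proof -
      let ?f = "\<lambda>x. ell DIM('a) q \<theta> lam powr (1 / (q - 1)) * exp (- (Theta q \<theta> + 2) * ln (norm x))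
       * profile_op DIM('a) q \<theta> lam (W (ln (norm x))) (W' (ln (norm x))) (W'' (ln (norm x))) * \<phi> x"
      have eq: "weak_form q \<theta> lam ?V \<phi> = (LINT x|lborel. ?f x)"
        by (rule barrier_weak_form[where T = ?T, OF open_greaterThanLessThan q ell_DIM_pos W(1-4) \<phi>(1)])
      have "0 \<le> - ?f x" for x
      proof (cases "x \<in> annulus ?T")
        case True
        then have "profile_op DIM('a) q \<theta> lam (W (ln (norm x))) (W' (ln (norm x))) (W'' (ln (norm x))) \<le> 0"
          by (intro sub) (simp add: annulus_def)
        then show ?thesis using \<phi>(2)[of x]
          by (simp add: mult_nonpos_nonneg mult_nonneg_nonpos)
      next
        case False
        then have "x \<notin> closure {x. \<phi> x \<noteq> 0}" using \<phi>(1) by (auto simp only: C1c_on_def)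
        then have "\<phi> x = 0" by (rule C1c_on_eq_0(1))
        then show ?thesis by simp
      qed
      then have "0 \<le> (LINT x|lborel. - ?f x)" by (intro Bochner_Integration.integral_nonneg)
      then show ?thesis unfolding eq by simp
    qed
  qed auto
  then show ?thesis by (simp add: barrier_def)
qed

lemma solution_le_barrier:
  assumes W: "\<And>t. t \<in> {a<..<c} \<Longrightarrow> DERIV W t :> W' t" "\<And>t. t \<in> {a<..<c} \<Longrightarrow> DERIV W' t :> W'' t"
      "continuous_on {a<..<c} W''" "\<And>t. t \<in> {a<..<c} \<Longrightarrow> W t > 0" "continuous_on {a..c} W"
    and super: "\<And>t. t \<in> {a<..<c} \<Longrightarrow> profile_op DIM('a) q \<theta> lam (W t) (W' t) (W'' t) \<ge> 0"
    and bd: "\<And>x. x \<in> annulus {a, c} \<Longrightarrow> u x < U x * W (ln (norm x))"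
    and x: "x \<in> annulus {a<..<c}"
  shows "u x \<le> U x * W (ln (norm x))"
proof -
  let ?T = "{a<..<c}" and ?V = "barrier q \<theta> lam W :: 'a \<Rightarrow> real"
  let ?K = "{x \<in> annulus {a..c}. ?V x \<le> u x}"
  have contW': "continuous_on ?T W'"
    using W(2) by (meson DERIV_isCont continuous_at_imp_continuous_on)
  have K: "compact ?K" "?K \<subseteq> annulus ?T"
    using compact_contact_set[of a c u ?V, OF solution_properties(2)
        continuous_on_barrier[OF subset_refl W(5)]] bd unfolding barrier_def by blast+
  have "u x \<le> ?V x"
  proof (rule weak_comparison[OF open_annulus annulus_subset q
        barrier_C1_on[OF W(1) contW'] _ solution_properties(1,3) K _ _ _ x])
    show "?V x > 0" if "x \<in> annulus ?T" for x
      using U_pos[of x] W(4) that by (simp add: barrier_def annulus_def)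
    show "u x \<le> ?V x" if "x \<in> annulus ?T - ?K" for x
      using that by (auto simp: annulus_def)
    show "weak_form q \<theta> lam u \<phi> \<le> 0" if "C1c_on (annulus ?T) \<phi>" for \<phi>
      using solution_properties(4)[OF _ that] by simp
    show "weak_form q \<theta> lam ?V \<phi> \<ge> 0" if \<phi>: "C1c_on (annulus ?T) \<phi>" "\<And>x. \<phi> x \<ge> 0" for \<phi>
    proof -
      let ?f = "\<lambda>x. ell DIM('a) q \<theta> lam powr (1 / (q - 1)) * exp (- (Theta q \<theta> + 2) * ln (norm x))
       * profile_op DIM('a) q \<theta> lam (W (ln (norm x))) (W' (ln (norm x))) (W'' (ln (norm x))) * \<phi> x"
      have eq: "weak_form q \<theta> lam ?V \<phi> = (LINT x|lborel. ?f x)"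
        by (rule barrier_weak_form[where T = ?T, OF open_greaterThanLessThan q ell_DIM_pos W(1-4) \<phi>(1)])
      have "0 \<le> ?f x" for x
      proof (cases "x \<in> annulus ?T")
        case True
        then have "profile_op DIM('a) q \<theta> lam (W (ln (norm x))) (W' (ln (norm x))) (W'' (ln (norm x))) \<ge> 0"
          by (intro super) (simp add: annulus_def)
        then show ?thesis using \<phi>(2)[of x] by simp
      next
        case False
        then have "x \<notin> closure {x. \<phi> x \<noteq> 0}" using \<phi>(1) by (auto simp only: C1c_on_def)
        then have "\<phi> x = 0" by (rule C1c_on_eq_0(1))
        then show ?thesis by simp
      qed
      then show ?thesis
        unfolding eq by (intro Bochner_Integration.integral_nonneg)
    qed
  qed auto
  then show ?thesis by (simp add: barrier_def)
qed

end

subsection \<open>Bounds for positive solutions\<close>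

context positive_solution
begin

text \<open>The barrier is \<open>K cos(t - t\<^sub>0)\<^bsup>-2/(q-1)\<^esup>\<close>; the exponent balances the absorption term
  against the second derivative.\<close>

lemma upper_bound:
  obtains M where "M > 0" "\<And>x. x \<noteq> 0 \<Longrightarrow> u x \<le> M * U x"
proof -
  define l where "l = ell DIM('a) q \<theta> lam"
  define b where "b = 2 * Theta q \<theta> - (real DIM('a) - 2)"
  define k where "k = 2 / (q - 1)"
  \<comment> \<open>\<open>m\<close> bounds the four terms that compete with the absorption, using
    that sine and cosine are at most one in modulus; \<open>K\<close> solves
    \<open>l * K powr (q - 1) = m\<close>. Neither depends on the centre, which makes the bound
    uniform.\<close>
  define m where "m = l + \<bar>b\<bar> * k + k + k * (k + 1)"
  define K where "K = (m / l) powr (1 / (q - 1))"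
  have l: "l > 0" using ell_DIM_pos by (simp add: l_def)
  have k: "k > 0" using q by (simp add: k_def)
  have m: "m > 0" using l k by (simp add: m_def add_pos_nonneg)
  have K: "K > 0" "l * K powr (q - 1) = m"
    using m l q by (simp_all add: K_def powr_powr)
  have "u x0 \<le> K * U x0" if "x0 \<noteq> 0" for x0
  proof -
    define t0 where "t0 = ln (norm x0)"
    have "continuous_on (annulus {t0 - pi..t0 + pi}) (\<lambda>x. u x / U x)"
    proof (rule continuous_on_divide[OF solution_properties(2)])
      show "continuous_on (annulus {t0 - pi..t0 + pi}) U"
        unfolding U_ext_def[abs_def] by (intro continuous_intros continuous_on_ln_norm annulus_subset)
          (auto simp: annulus_def)
      show "\<forall>x\<in>annulus {t0 - pi..t0 + pi}. U x \<noteq> 0" using U_pos by (simp add: less_imp_neq[symmetric])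
    qed
    then have "bounded ((\<lambda>x. u x / U x) ` annulus {t0 - pi..t0 + pi})"
      by (intro compact_imp_bounded compact_continuous_image compact_annulus)
    then obtain B where B: "B > 0" "\<And>x. x \<in> annulus {t0 - pi..t0 + pi} \<Longrightarrow> \<bar>u x / U x\<bar> \<le> B"
      unfolding bounded_pos by auto
    \<comment> \<open>The barrier is cut off before it blows up: where the cosine equals
      \<open>c\<close> its value \<open>K * c powr (- k)\<close> exceeds the local bound
      \<open>B\<close> of \<open>u / U\<close>. \<open>B\<close> depends on the centre but affects
      only the length of the interval, not the value \<open>K\<close> at \<open>t0\<close>. The cap
      \<open>1 / 2\<close> keeps \<open>s\<close> positive.\<close>
    define c where "c = min (1 / 2) ((K / (2 * B)) powr (1 / k))"
    have c: "0 < c" "c < 1" using B K by (auto simp: c_def)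
    have "c powr k \<le> ((K / (2 * B)) powr (1 / k)) powr k"
      using c k by (intro powr_mono2) (auto simp: c_def)
    also have "\<dots> = K / (2 * B)" using k B K by (simp add: powr_powr)
    finally have "B < K * c powr (- k)"
      using c B K by (simp add: powr_minus field_simps)
    define s where "s = arccos c"
    have s: "0 < s" "s < pi / 2" "cos s = c"
      using c arccos_lt_bounded[of c] arccos_less_mono[of c 0] by (simp_all add: s_def)
    define W where "W t = K * cos (t - t0) powr (- k)" for t
    define W' where "W' t = K * k * (sin (t - t0) * cos (t - t0) powr (- k - 1))" for t
    define W'' where "W'' t = K * k * (cos (t - t0) * cos (t - t0) powr (- k - 1)
        + (k + 1) * (sin (t - t0))\<^sup>2 * cos (t - t0) powr (- k - 2))" for t
    have cos_pos: "cos (t - t0) > 0" if "t \<in> {t0 - s..t0 + s}" for t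
      using that s by (intro cos_gt_zero_pi) auto
    have Dcos: "DERIV (\<lambda>t. cos (t - t0) powr r) t :> r * cos (t - t0) powr (r - 1) * (- sin (t - t0))"
      if "t \<in> {t0 - s..t0 + s}" for t r
    proof -
      have "DERIV (\<lambda>t. cos (t - t0)) t :> - sin (t - t0)" by (auto intro!: derivative_eq_intros)
      from DERIV_fun_powr[OF this cos_pos[OF that], of r] show ?thesis by simp
    qed
    have D: "DERIV W t :> W' t" "DERIV W' t :> W'' t" if "t \<in> {t0 - s..t0 + s}" for t
    proof -
      have "DERIV W t :> K * (- k * cos (t - t0) powr (- k - 1) * (- sin (t - t0)))"
        unfolding W_def by (intro DERIV_cmult Dcos[OF that])
      then show "DERIV W t :> W' t" by (simp add: W'_def algebra_simps)
      have "DERIV (\<lambda>t. sin (t - t0)) t :> cos (t - t0)" by (auto intro!: derivative_eq_intros)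
      then have "DERIV W' t :> K * k * (cos (t - t0) * cos (t - t0) powr (- k - 1)
          + (- k - 1) * cos (t - t0) powr (- k - 1 - 1) * (- sin (t - t0)) * sin (t - t0))"
        unfolding W'_def by (intro DERIV_cmult DERIV_mult Dcos[OF that])
      moreover have "- k - 1 - 1 = - k - 2" by simp
      ultimately show "DERIV W' t :> W'' t"
        unfolding W''_def by (simp only:) (simp add: algebra_simps power2_eq_square)
    qed
    have contW: "continuous_on {t0 - s..t0 + s} W"
      using D(1) by (meson DERIV_isCont continuous_at_imp_continuous_on)
    have contW'': "continuous_on {t0 - s<..<t0 + s} W''"
      unfolding W''_def using cos_pos by (intro continuous_intros) (auto simp: less_le)
    have super: "profile_op DIM('a) q \<theta> lam (W t) (W' t) (W'' t) \<ge> 0" if "t \<in> {t0 - s<..<t0 + s}" for t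
    proof -
      define S where "S = sin (t - t0)"
      define C where "C = cos (t - t0)"
      define P where "P = C powr (- k - 2)"
      have C: "C > 0" using cos_pos[of t] that by (simp add: C_def)
      have P: "P > 0" using C by (simp add: P_def)
      have 1: "C powr (- k - 1) = C * P"
      proof -
        have "- k - 1 - 1 = - k - 2" by simp
        then show ?thesis using powr_diff_one[OF C, of "- k - 1"] unfolding P_def
          by (simp only: mult.commute)
      qed
      have 2: "C powr (- k) = C\<^sup>2 * P"
        using powr_diff_one[OF C, of "- k"] by (simp add: 1 power2_eq_square)
      have kq: "- k * q = - k - 2" using q by (simp add: k_def field_simps)
      have 3: "(K * C powr (- k)) powr q = K * K powr (q - 1) * P"
        using K(1) C kq powr_diff_one[OF K(1), of q] by (simp add: powr_mult powr_powr P_def)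
      have sc: "S\<^sup>2 \<le> 1" "C\<^sup>2 \<le> 1" "\<bar>S * C\<bar> \<le> 1"
        by (auto simp: S_def C_def abs_mult abs_square_le_1 intro: mult_le_one)
      have "profile_op DIM('a) q \<theta> lam (W t) (W' t) (W'' t)
          = K * P * (l * K powr (q - 1) - l * C\<^sup>2 + b * k * (S * C) - k * C\<^sup>2 - k * (k + 1) * S\<^sup>2)"
        unfolding profile_op_def l_def[symmetric] b_def[symmetric] W_def W'_def W''_def
          S_def[symmetric] C_def[symmetric] 3 unfolding 1 2 P_def[symmetric]
        by (simp add: algebra_simps power2_eq_square)
      also have "\<dots> \<ge> 0"
      proof -
        have "l * C\<^sup>2 \<le> l" "k * C\<^sup>2 \<le> k" "k * (k + 1) * S\<^sup>2 \<le> k * (k + 1)"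
          using sc l k by (simp_all add: mult_left_le)
        moreover have "\<bar>b * k * (S * C)\<bar> \<le> \<bar>b\<bar> * k"
          using sc(3) k by (simp add: abs_mult mult_left_le)
        ultimately show ?thesis
          using K P by (intro mult_nonneg_nonneg) (auto simp: m_def abs_le_iff)
      qed
      finally show ?thesis .
    qed
    have bd: "u x < U x * W (ln (norm x))" if "x \<in> annulus {t0 - s, t0 + s}" for x
    proof -
      have "cos (ln (norm x) - t0) = c" using that s by (auto simp: annulus_def)
      then have "B < W (ln (norm x))" using \<open>B < K * c powr (- k)\<close> by (simp add: W_def)
      moreover have "x \<in> annulus {t0 - pi..t0 + pi}" using that s by (auto simp: annulus_def)
      then have "u x / U x \<le> B" using B(2)[of x] by linarith
      ultimately have "u x / U x < W (ln (norm x))" by linarith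
      then show ?thesis using U_pos[of x] by (simp add: field_simps)
    qed
    have "u x0 \<le> U x0 * W (ln (norm x0))"
    proof (rule solution_le_barrier[OF D _ _ contW super bd])
      show "x0 \<in> annulus {t0 - s<..<t0 + s}" using that s by (simp add: annulus_def t0_def)
      show "W t > 0" if "t \<in> {t0 - s<..<t0 + s}" for t
        using K cos_pos[of t] that by (simp add: W_def)
    qed (use contW'' in auto)
    then show ?thesis by (simp add: W_def t0_def mult.commute)
  qed
  then show ?thesis using that K(1) by blast
qed

text \<open>Here \<open>lam > lambda_H\<close> enters: the linearisation at \<open>0\<close> oscillates, with solutions
  \<open>e\<^bsup>bt/2\<^esup> cos(\<surd>(lam - lambda_H) t)\<close>.\<close>

lemma lower_bound:
  obtains e where "e > 0" "\<And>x. x \<noteq> 0 \<Longrightarrow> e * U x \<le> u x"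
proof -
  define l where "l = ell DIM('a) q \<theta> lam"
  define b where "b = 2 * Theta q \<theta> - (real DIM('a) - 2)"
  define m where "m = lam - lambda_H DIM('a)"
  \<comment> \<open>The critical frequency is \<open>sqrt m\<close>. The slower one turns the linear
    part of the operator into \<open>- (m / 2) W\<close>, a surplus that pays for the
    absorption.\<close>
  define \<kappa> where "\<kappa> = sqrt (m / 2)"
  \<comment> \<open>A quarter period: the cosine vanishes at both ends, so any positive
    \<open>u\<close> lies above the barrier there.\<close>
  define s where "s = pi / (2 * \<kappa>)"
  \<comment> \<open>Chosen so that \<open>l * W t powr (q - 1) \<le> m / 2\<close> on the whole
    interval; the exponential factor offsets the growth of \<open>exp (b / 2 * (t - t0))\<close> up
    to distance \<open>s\<close>. No dependence on the centre.\<close>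
  define e where "e = (m / (2 * l)) powr (1 / (q - 1)) * exp (- \<bar>b\<bar> * s / 2)"
  have l: "l > 0" using ell_DIM_pos by (simp add: l_def)
  have m: "m > 0" using lam by (simp add: m_def)
  have lbm: "l = b\<^sup>2 / 4 + m"
    by (simp add: l_def b_def m_def ell_def lambda_H_def power2_eq_square field_simps)
  have \<kappa>: "\<kappa> > 0" "\<kappa>\<^sup>2 = m / 2" using m by (simp_all add: \<kappa>_def)
  have s: "s > 0" "\<kappa> * s = pi / 2" using \<kappa> by (simp_all add: s_def)
  have e: "e > 0" using m l by (simp add: e_def)
  have "e * U x0 \<le> u x0" if "x0 \<noteq> 0" for x0
  proof -
    define t0 where "t0 = ln (norm x0)"
    define E where "E t = e * exp (b / 2 * (t - t0))" for t
    define S where "S t = sin (\<kappa> * (t - t0))" for t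
    define C where "C t = cos (\<kappa> * (t - t0))" for t
    define W where "W t = E t * C t" for t
    define W' where "W' t = E t * (b / 2 * C t - \<kappa> * S t)" for t
    define W'' where "W'' t = E t * (b\<^sup>2 / 4 * C t - b * \<kappa> * S t - \<kappa>\<^sup>2 * C t)" for t
    have D0: "DERIV E t :> b / 2 * E t" "DERIV S t :> \<kappa> * C t" "DERIV C t :> - \<kappa> * S t" for t
      unfolding E_def S_def C_def by (auto intro!: derivative_eq_intros)
    have D: "DERIV W t :> W' t" "DERIV W' t :> W'' t" for t
      unfolding W_def W'_def W''_def
      by (auto intro!: derivative_eq_intros D0 simp: field_simps power2_eq_square)
    have cont: "continuous_on A W" "continuous_on A W''" for A
      unfolding W_def W''_def E_def S_def C_def by (intro continuous_intros)+
    have C_pos: "C t > 0" if "t \<in> {t0 - s<..<t0 + s}" for t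
    proof -
      have "\<kappa> * (t - t0) < \<kappa> * s" "\<kappa> * (- s) < \<kappa> * (t - t0)"
        using that \<kappa>(1) by (intro mult_strict_left_mono; simp)+
      then show ?thesis unfolding C_def using s by (intro cos_gt_zero_pi) auto
    qed
    have W_pos: "W t > 0" if "t \<in> {t0 - s<..<t0 + s}" for t
      using C_pos[OF that] e by (simp add: W_def E_def)
    have sub: "profile_op DIM('a) q \<theta> lam (W t) (W' t) (W'' t) \<le> 0" if t: "t \<in> {t0 - s<..<t0 + s}" for t
    proof -
      have "b / 2 * (t - t0) \<le> \<bar>b\<bar> * s / 2"
      proof -
        have "b * (t - t0) \<le> \<bar>b\<bar> * \<bar>t - t0\<bar>" by (metis abs_ge_self abs_mult)
        also have "\<dots> \<le> \<bar>b\<bar> * s" using t by (intro mult_left_mono) auto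
        finally show ?thesis by simp
      qed
      then have "E t \<le> (m / (2 * l)) powr (1 / (q - 1))"
        unfolding E_def e_def by (simp add: mult.assoc exp_add[symmetric] mult_left_le)
      moreover have "W t \<le> E t" using e by (simp add: W_def E_def C_def mult_left_le)
      ultimately have "W t powr (q - 1) \<le> ((m / (2 * l)) powr (1 / (q - 1))) powr (q - 1)"
        using W_pos[OF t] q by (intro powr_mono2) auto
      also have "\<dots> = m / (2 * l)" using q m l by (simp add: powr_powr)
      finally have le: "l * W t powr (q - 1) \<le> m / 2" using l by (simp add: field_simps)
      have "profile_op DIM('a) q \<theta> lam (W t) (W' t) (W'' t) = (l * W t powr (q - 1) - m / 2) * W t"
        unfolding profile_op_def l_def[symmetric] b_def[symmetric] powr_diff_one[OF W_pos[OF t], of q]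
        unfolding W_def W'_def W''_def \<kappa>(2) unfolding lbm
        by (simp add: algebra_simps power2_eq_square)
      then show ?thesis using le W_pos[OF t] by (simp add: mult_nonpos_nonneg)
    qed
    have bd: "U x * W (ln (norm x)) < u x" if "x \<in> annulus {t0 - s, t0 + s}" for x
    proof -
      have "cos (\<kappa> * s) = 0" unfolding s(2) by simp
      then have "C (ln (norm x)) = 0" using that by (auto simp: annulus_def C_def)
      then show ?thesis using solution_properties(3)[OF that] by (simp add: W_def)
    qed
    have "U x0 * W (ln (norm x0)) \<le> u x0"
    proof (rule barrier_le_solution[OF D cont(2) W_pos cont(1) sub bd])
      show "x0 \<in> annulus {t0 - s<..<t0 + s}" using that s by (simp add: annulus_def t0_def)
    qed auto
    then show ?thesis by (simp add: W_def E_def C_def t0_def mult.commute)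
  qed
  then show ?thesis using that e by blast
qed

end

section \<open>Squeezing a solution onto \<open>U0\<close>\<close>

text \<open>Relative to the parabola \<open>A (1 + (g y)^2)\<close>, its drift and its second
  derivative are of order \<open>g\<close>, because \<open>2 |g y| \<le> 1 + (g y)^2\<close>.
  Uniformity in \<open>y\<close> is the point: \<open>g\<close> can be fixed before the length of
  the interval, which depends on it.\<close>

lemma exists_slope:
  fixes b d :: real
  assumes "d > 0"
  obtains g where "0 < g" "\<And>p y A. 0 \<le> A \<Longrightarrow> \<bar>b * (2 * A * g\<^sup>2 * y)\<bar> + 2 * A * g\<^sup>2 \<le> d * (A * (1 + (g * y)\<^sup>2))"
proof
  \<comment> \<open>In \<open>\<bar>b\<bar> + 2\<close> the first summand comes from the drift and
    the second from the second derivative; the cap \<open>1\<close> gives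
    \<open>g * g \<le> g\<close>.\<close>
  define g where "g = min 1 (d / (\<bar>b\<bar> + 2))"
  show g: "0 < g" using assms by (simp add: g_def)
  have "g \<le> d / (\<bar>b\<bar> + 2)" by (simp add: g_def)
  moreover have "0 < \<bar>b\<bar> + 2" by linarith
  ultimately have g1: "g \<le> 1" "g * (\<bar>b\<bar> + 2) \<le> d"
    by (simp add: g_def, simp only: pos_le_divide_eq)
  fix y A :: real assume A: "0 \<le> A"
  let ?P = "1 + (g * y)\<^sup>2"
  have 1: "2 * \<bar>g * y\<bar> \<le> ?P"
    using sum_squares_bound[of 1 "\<bar>g * y\<bar>"] by simp
  have "\<bar>b * (2 * A * g\<^sup>2 * y)\<bar> = \<bar>b\<bar> * A * g * (2 * \<bar>g * y\<bar>)"
    using A g by (simp add: abs_mult power2_eq_square)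
  also have "\<dots> \<le> \<bar>b\<bar> * A * g * ?P" using 1 A g by (intro mult_left_mono) auto
  finally have 2: "\<bar>b * (2 * A * g\<^sup>2 * y)\<bar> \<le> \<bar>b\<bar> * A * g * ?P" .
  have "g * g \<le> g * ?P" using g g1(1) by (intro mult_left_mono) (auto intro: order_trans[of _ 1])
  then have "2 * A * g\<^sup>2 \<le> 2 * A * g * ?P"
    using A by (simp add: power2_eq_square mult.assoc mult_left_mono)
  with 2 have "\<bar>b * (2 * A * g\<^sup>2 * y)\<bar> + 2 * A * g\<^sup>2 \<le> A * ?P * (g * (\<bar>b\<bar> + 2))"
    by (simp add: algebra_simps)
  also have "\<dots> \<le> A * ?P * d" using A g1(2) by (intro mult_left_mono) auto
  finally show "\<bar>b * (2 * A * g\<^sup>2 * y)\<bar> + 2 * A * g\<^sup>2 \<le> d * (A * ?P)" by (simp add: mult.commute)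
qed

context positive_solution
begin

lemma solution_le_near:
  assumes \<delta>: "\<delta> > 0" and x0: "x0 \<noteq> 0"
  shows "u x0 \<le> (1 + 2 * \<delta>) * U x0"
proof -
  define l where "l = ell DIM('a) q \<theta> lam"
  define b where "b = 2 * Theta q \<theta> - (real DIM('a) - 2)"
  \<comment> \<open>The reserve gained by the shift: since \<open>W \<ge> 1 + \<delta>\<close>, the
    zero-order term is at least \<open>d * W\<close>, which pays for the derivatives of the
    parabola.\<close>
  define d where "d = l * ((1 + \<delta>) powr (q - 1) - 1)"
  define t0 where "t0 = ln (norm x0)"
  have l: "l > 0" using ell_DIM_pos by (simp add: l_def)
  have "1 powr (q - 1) < (1 + \<delta>) powr (q - 1)" using \<delta> q by (intro powr_less_mono2) auto
  then have d: "d > 0" using l by (simp add: d_def)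
  obtain g where g: "g > 0"
    "\<And>y A. 0 \<le> A \<Longrightarrow> \<bar>b * (2 * A * g\<^sup>2 * y)\<bar> + 2 * A * g\<^sup>2 \<le> d * (A * (1 + (g * y)\<^sup>2))"
    using exists_slope[OF d, of b] by metis
  obtain M where M: "M > 0" "\<And>x. x \<noteq> 0 \<Longrightarrow> u x \<le> M * U x" using upper_bound by metis
  \<comment> \<open>At distance \<open>s\<close> the parabola contributes
    \<open>\<delta> * (g * s)\<^sup>2 = M\<close> and lifts the barrier above the uniform bound,
    while at the centre it is only \<open>1 + 2 * \<delta>\<close>.\<close>
  define s where "s = sqrt (M / \<delta>) / g"
  have s: "s > 0" "(g * s)\<^sup>2 = M / \<delta>" using M \<delta> g by (simp_all add: s_def)
  define W where "W t = 1 + \<delta> + \<delta> * (1 + (g * (t - t0))\<^sup>2)" for t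
  define W' where "W' t = 2 * \<delta> * g\<^sup>2 * (t - t0)" for t
  define W'' where "W'' t = 2 * \<delta> * g\<^sup>2" for t :: real
  have D: "DERIV W t :> W' t" "DERIV W' t :> W'' t" for t
    unfolding W_def W'_def W''_def
    by (auto intro!: derivative_eq_intros simp: power2_eq_square algebra_simps)
  have cont: "continuous_on A W" "continuous_on A W''" for A
    unfolding W_def W''_def by (intro continuous_intros)+
  have W1: "W t \<ge> 1 + \<delta>" for t using \<delta> by (simp add: W_def)
  have Wpos: "W t > 0" for t using W1[of t] \<delta> by linarith
  have super: "profile_op DIM('a) q \<theta> lam (W t) (W' t) (W'' t) \<ge> 0" for t
  proof -
    have "(1 + \<delta>) powr (q - 1) \<le> W t powr (q - 1)" using W1[of t] \<delta> q by (intro powr_mono2) auto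
    then have "d * W t \<le> l * (W t powr (q - 1) - 1) * W t"
      unfolding d_def using l Wpos[of t] by (intro mult_right_mono mult_left_mono) auto
    moreover have "d * (\<delta> * (1 + (g * (t - t0))\<^sup>2)) \<le> d * W t"
      using d \<delta> by (intro mult_left_mono) (simp_all add: W_def)
    moreover have "profile_op DIM('a) q \<theta> lam (W t) (W' t) (W'' t)
        = l * (W t powr (q - 1) - 1) * W t + (b * W' t - W'' t)"
      unfolding profile_op_def l_def[symmetric] b_def[symmetric] powr_diff_one[OF Wpos[of t], of q]
      by (simp add: algebra_simps)
    moreover have "\<bar>b * W' t\<bar> + W'' t \<le> d * (\<delta> * (1 + (g * (t - t0))\<^sup>2))"
      unfolding W'_def W''_def using g(2) \<delta> by simp
    ultimately show ?thesis by linarith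
  qed
  have bd: "u x < U x * W (ln (norm x))" if "x \<in> annulus {t0 - s, t0 + s}" for x
  proof -
    have "(g * (ln (norm x) - t0))\<^sup>2 = M / \<delta>" using that s(2) by (auto simp: annulus_def)
    then have "M < W (ln (norm x))" unfolding W_def using \<delta> by (simp add: algebra_simps)
    then have "M * U x < U x * W (ln (norm x))" using U_pos[of x] by simp
    then show ?thesis using M(2)[of x] that by (auto simp: annulus_def)
  qed
  have "u x0 \<le> U x0 * W (ln (norm x0))"
    by (rule solution_le_barrier[OF D cont(2) Wpos cont(1) super bd])
      (use x0 s in \<open>auto simp: annulus_def t0_def\<close>)
  then show ?thesis by (simp add: W_def t0_def algebra_simps)
qed

text \<open>Below \<open>1\<close> the reserve in the zero-order term carries a factor
  \<open>W\<close> and degenerates as \<open>W\<close> tends to \<open>0\<close>, and the concave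
  parabola does become negative. The uniform lower bound permits stopping at
  \<open>W = e / 2\<close>, already strictly below \<open>u / U\<close>; hence the factor
  \<open>e / 2\<close> in \<open>d\<close>.\<close>

lemma near_le_solution:
  assumes e: "0 < e" "e < 1" "\<And>x. x \<noteq> 0 \<Longrightarrow> e * U x \<le> u x"
    and \<delta>: "\<delta> > 0" "2 * \<delta> < 1 - e / 2" and x0: "x0 \<noteq> 0"
  shows "(1 - 2 * \<delta>) * U x0 \<le> u x0"
proof -
  define l where "l = ell DIM('a) q \<theta> lam"
  define b where "b = 2 * Theta q \<theta> - (real DIM('a) - 2)"
  define d where "d = l * ((1 - (1 - \<delta>) powr (q - 1)) * (e / 2))"
  define t0 where "t0 = ln (norm x0)"
  have l: "l > 0" using ell_DIM_pos by (simp add: l_def)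
  have "(1 - \<delta>) powr (q - 1) < 1 powr (q - 1)" using \<delta> e q by (intro powr_less_mono2) auto
  then have c: "0 < 1 - (1 - \<delta>) powr (q - 1)" by simp
  then have d: "d > 0" using l e by (simp add: d_def)
  obtain g where g: "g > 0"
    "\<And>y A. 0 \<le> A \<Longrightarrow> \<bar>b * (2 * A * g\<^sup>2 * y)\<bar> + 2 * A * g\<^sup>2 \<le> d * (A * (1 + (g * y)\<^sup>2))"
    using exists_slope[OF d, of b] by metis
  \<comment> \<open>Solves \<open>W (t0 + s) = e / 2\<close>; the hypothesis
    \<open>2 * \<delta> < 1 - e / 2\<close> makes the radicand positive.\<close>
  define s where "s = sqrt ((1 - 2 * \<delta> - e / 2) / \<delta>) / g"
  have s: "s > 0" "(g * s)\<^sup>2 = (1 - 2 * \<delta> - e / 2) / \<delta>" using \<delta> g by (simp_all add: s_def)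
  define W where "W t = 1 - \<delta> - \<delta> * (1 + (g * (t - t0))\<^sup>2)" for t
  define W' where "W' t = - (2 * \<delta> * g\<^sup>2 * (t - t0))" for t
  define W'' where "W'' t = - (2 * \<delta> * g\<^sup>2)" for t :: real
  have D: "DERIV W t :> W' t" "DERIV W' t :> W'' t" for t
    unfolding W_def W'_def W''_def
    by (auto intro!: derivative_eq_intros simp: power2_eq_square algebra_simps)
  have cont: "continuous_on A W" "continuous_on A W''" for A
    unfolding W_def W''_def by (intro continuous_intros)+
  have W_le: "W t \<le> 1 - \<delta>" for t using \<delta> by (simp add: W_def)
  have W_end: "W t = e / 2" if "(g * (t - t0))\<^sup>2 = (g * s)\<^sup>2" for t
    unfolding W_def that s(2) using \<delta> by (simp add: field_simps)
  have W_ge: "W t \<ge> e / 2" if "t \<in> {t0 - s<..<t0 + s}" for t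
  proof -
    have "\<bar>g * (t - t0)\<bar> \<le> \<bar>g * s\<bar>" using that g(1) s(1) by (simp add: abs_mult) (simp add: abs_le_iff)
    then have "(g * (t - t0))\<^sup>2 \<le> (g * s)\<^sup>2" by (simp only: abs_le_square_iff)
    then have "\<delta> * (g * (t - t0))\<^sup>2 \<le> \<delta> * (g * s)\<^sup>2" using \<delta> by simp
    moreover have "W t - W (t0 + s) = \<delta> * (g * s)\<^sup>2 - \<delta> * (g * (t - t0))\<^sup>2"
      by (simp add: W_def algebra_simps)
    ultimately show ?thesis using W_end[of "t0 + s"] by simp
  qed
  have sub: "profile_op DIM('a) q \<theta> lam (W t) (W' t) (W'' t) \<le> 0" if t: "t \<in> {t0 - s<..<t0 + s}" for t
  proof -
    have Wpos: "W t > 0" using W_ge[OF t] e by linarith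
    have "W t powr (q - 1) \<le> (1 - \<delta>) powr (q - 1)" using W_le[of t] Wpos q by (intro powr_mono2) auto
    then have "d \<le> l * ((1 - W t powr (q - 1)) * W t)"
      unfolding d_def using l c e W_ge[OF t] by (intro mult_left_mono mult_mono) auto
    \<comment> \<open>Positivity of \<open>W\<close> bounds the subtracted parabola by one, so the
      constant reserve \<open>d\<close> is enough.\<close>
    moreover have "d * (\<delta> * (1 + (g * (t - t0))\<^sup>2)) \<le> d * 1"
      using d \<delta> Wpos by (intro mult_left_mono) (simp_all add: W_def)
    moreover have "profile_op DIM('a) q \<theta> lam (W t) (W' t) (W'' t)
        = (b * W' t - W'' t) - l * ((1 - W t powr (q - 1)) * W t)"
      unfolding profile_op_def l_def[symmetric] b_def[symmetric] powr_diff_one[OF Wpos, of q]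
      by (simp add: algebra_simps)
    moreover have "\<bar>b * W' t\<bar> - W'' t \<le> d * (\<delta> * (1 + (g * (t - t0))\<^sup>2))"
      unfolding W'_def W''_def using g(2)[of \<delta> "t - t0"] \<delta> by simp
    ultimately show ?thesis by linarith
  qed
  have bd: "U x * W (ln (norm x)) < u x" if "x \<in> annulus {t0 - s, t0 + s}" for x
  proof -
    have "W (ln (norm x)) = e / 2" using that by (intro W_end) (auto simp: annulus_def)
    then have "U x * W (ln (norm x)) < e * U x" using U_pos[of x] e by simp
    then show ?thesis using e(3)[of x] that by (auto simp: annulus_def)
  qed
  have "U x0 * W (ln (norm x0)) \<le> u x0"
  proof (rule barrier_le_solution[OF D cont(2) _ cont(1) sub bd])
    show "W t > 0" if "t \<in> {t0 - s<..<t0 + s}" for t using W_ge[OF that] e by linarith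
  qed (use x0 s in \<open>auto simp: annulus_def t0_def\<close>)
  then show ?thesis by (simp add: W_def t0_def algebra_simps)
qed

lemma solution_eq: "x \<noteq> 0 \<Longrightarrow> u x = U x"
proof (rule antisym)
  assume x: "x \<noteq> 0"
  show "u x \<le> U x"
  proof (rule field_le_epsilon)
    fix h :: real assume h: "h > 0"
    then show "u x \<le> U x + h"
    proof -
      have "(1 + 2 * (h / (2 * U x))) * U x = U x + h" using U_pos[of x] by (simp add: field_simps)
      then show ?thesis using solution_le_near[OF _ x, of "h / (2 * U x)"] h U_pos[of x] by simp
    qed
  qed
  obtain e' where e': "e' > 0" "\<And>x. x \<noteq> 0 \<Longrightarrow> e' * U x \<le> u x" using lower_bound by metis
  define e where "e = min e' (1 / 2)"
  have e: "0 < e" "e < 1" using e' by (auto simp: e_def)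
  have eU: "e * U x \<le> u x" if "x \<noteq> 0" for x
  proof -
    have "e * U x \<le> e' * U x" using U_pos[of x] by (intro mult_right_mono) (simp_all add: e_def)
    then show ?thesis using e'(2)[OF that] by linarith
  qed
  show "U x \<le> u x"
  proof (rule field_le_epsilon)
    fix h :: real assume h: "h > 0"
    \<comment> \<open>With \<open>e \<le> 1 / 2\<close> the value \<open>1 / 8\<close> meets the
      side condition; the other bound keeps the error \<open>2 * \<delta> * U x\<close> below
      \<open>h\<close>.\<close>
    define \<delta> where "\<delta> = min (1 / 8) (h / (2 * U x))"
    have \<delta>: "\<delta> > 0" "2 * \<delta> < 1 - e / 2" using h U_pos[of x] e by (auto simp: \<delta>_def)
    have "2 * \<delta> * U x \<le> h" using U_pos[of x] by (simp add: \<delta>_def min_def field_simps)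
    then show "U x \<le> u x + h"
      using near_le_solution[OF e eU \<delta> x] by (simp add: algebra_simps)
  qed
qed

end

section \<open>Existence and conclusion\<close>

text \<open>The barrier with constant profile \<open>1\<close> has a vanishing integrand in its weak
  form. It agrees with \<open>U0\<close> off the origin, which suffices both for the regularity and
  for the equation.\<close>

lemma is_solution_U0:
  assumes "q > 1" "lam > lambda_H CARD('n::finite)"
  shows "is_solution q \<theta> lam (U0 q \<theta> lam :: real ^ 'n \<Rightarrow> real)"
proof -
  let ?U = "U0 q \<theta> lam :: real ^ 'n \<Rightarrow> real"
  let ?V = "barrier q \<theta> lam (\<lambda>_. 1) :: real ^ 'n \<Rightarrow> real"
  have l: "ell DIM(real ^ 'n) q \<theta> lam > 0" using assms by (simp add: ell_pos)
  have eq: "?V x = ?U x" if "x \<in> - {0}" for x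
    using that by (simp add: barrier_def U_ext_def U0_def powr_def)
  have "C1_on (annulus UNIV) ?V"
    by (rule barrier_C1_on[where W' = "\<lambda>_. 0"]) auto
  then have "C1_on (- {0}) ?U" using C1_on_cong[of "- {0}" ?V ?U] eq
    by (simp add: annulus_UNIV open_Compl)
  moreover have "?U x > 0" if "x \<in> - {0}" for x
    using l that by (simp add: U0_def)
  moreover have "weak_form q \<theta> lam ?U \<phi> = 0" if \<phi>: "C1c_on (- {0}) \<phi>" for \<phi>
  proof -
    have "weak_form q \<theta> lam ?U \<phi> = weak_form q \<theta> lam ?V \<phi>"
      by (rule weak_form_cong[OF _ \<phi> eq[symmetric]]) (simp_all add: open_Compl)
    also have "\<dots> = 0"
      by (subst barrier_weak_form[where T = UNIV and W' = "\<lambda>_. 0" and W'' = "\<lambda>_. 0"])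
        (use assms l \<phi> in \<open>simp_all add: annulus_UNIV profile_op_def\<close>)
    finally show ?thesis .
  qed
  ultimately show ?thesis by (simp add: is_solution_iff_weak_form)
qed

theorem theorem1p1:
  fixes q \<theta> lam :: real
  assumes "CARD('n::finite) \<ge> 3"
    and "q > 1"
    and "lam > lambda_H CARD('n)"
  shows "is_solution q \<theta> lam (U0 q \<theta> lam :: real ^ 'n \<Rightarrow> real) \<and>
    (\<forall>u :: real ^ 'n \<Rightarrow> real. is_solution q \<theta> lam u \<longrightarrow> (\<forall>x\<in>- {0}. u x = U0 q \<theta> lam x))"
proof (intro conjI allI impI ballI)
  show "is_solution q \<theta> lam (U0 q \<theta> lam :: real ^ 'n \<Rightarrow> real)"
    by (rule is_solution_U0[OF assms(2,3)])
  fix u :: "real ^ 'n \<Rightarrow> real" and x :: "real ^ 'n"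
  assume u: "is_solution q \<theta> lam u" and x: "x \<in> - {0}"
  interpret positive_solution q \<theta> lam u
    using u assms by unfold_locales (auto simp: is_solution_iff_weak_form)
  show "u x = U0 q \<theta> lam x"
    using x solution_eq[of x] by (simp add: U_ext_def U0_def powr_def)
qed

end
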